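(* Let $0<\nu<\frac12$ and $\lambda>0$. The density $\mathfrak{l}_\nu(x,t)=\Pr\{\mathcal{L}^\nu(t)\in dx\}/dx$ of the process $\mathcal{L}^\nu(t)$ is, for $x>0$, $t>0$, $$\mathfrak{l}_\nu(x,t)=\int_0^t l_{2\nu}(x,s)\,h_\nu(t-s,2\lambda x)\,ds+2\lambda\int_0^t l_\nu(2\lambda x,s)\,h_{2\nu}(t-s,x)\,ds$$ $$=\int_0^t\frac{1}{s^{2\nu}}W_{-2\nu,1-2\nu}\left(-\frac{x}{s^{2\nu}}\right)h_\nu(t-s,2\lambda x)\,ds+2\lambda\int_0^t\frac{1}{s^{\nu}}W_{-\nu,1-\nu}\left(-\frac{2\lambda x}{s^{\nu}}\right)h_{2\nu}(t-s,x)\,ds,$$ and its time Laplace transform is, for $\mu>0$, $$\int_0^\infty e^{-\mu t}\,\mathfrak{l}_\nu(x,t)\,dt=\mu^{2\nu-1}e^{-x\mu^{2\nu}}e^{-2\lambda x\mu^\nu}+2\lambda\mu^{\nu-1}e^{-2\lambda x\mu^\nu}e^{-x\mu^{2\nu}}.$$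
   Context: For $0<\alpha<1$, $H^\alpha(t)$, $t>0$, is the stable subordinator with $\mathbb{E}e^{-\mu H^\alpha(t)}=e^{-t\mu^\alpha}$, $\mu>0$, and $h_\alpha(x,t)$ is its density in $x$ at time $t$. $L^\alpha(t)$ is the inverse of $H^\alpha$, i.e. $\Pr\{L^\alpha(t)<x\}=\Pr\{H^\alpha(x)>t\}$, and $l_\alpha(x,t)$ is its density in $x$ at time $t$. Let $H_1^{2\nu}$, $H_2^\nu$ be independent stable subordinators of orders $2\nu$ and $\nu$, $\mathcal{H}^\nu(t)=H_1^{2\nu}(t)+(2\lambda)^{1/\nu}H_2^\nu(t)$, and $\mathcal{L}^\nu(t)=\inf\{s>0:\mathcal{H}^\nu(s)\ge t\}$, $t>0$. The Wright function is $W_{a,b}(x)=\sum_{k=0}^\infty\frac{x^k}{k!\,\Gamma(ak+b)}$, $x\in\mathbb{R}$, $a>-1$, $b\in\mathbb{C}$. *)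

theory Defs
  imports "HOL-Probability.Probability"
begin

(* The subordinator with Laplace exponent \<mu>\<^sup>\<alpha>.  The path properties are required for every
   \<omega> (not only almost surely), so that first-passage times are measurable without completing M;
   left limits come for free from monotonicity.  Only the values at times t \<ge> 0 matter. *)
locale stable_subordinator = prob_space M for M :: "'a measure" +
  fixes \<alpha> :: real and X :: "real \<Rightarrow> 'a \<Rightarrow> real"
  assumes order: "0 < \<alpha>" "\<alpha> < 1"
    and random_variable: "\<And>t. t \<ge> 0 \<Longrightarrow> random_variable borel (X t)"
    and start: "\<And>\<omega>. \<omega> \<in> space M \<Longrightarrow> X 0 \<omega> = 0"
    and nondecreasing: "\<And>\<omega>. \<omega> \<in> space M \<Longrightarrow> mono_on {0..} (\<lambda>t. X t \<omega>)"
    and right_continuous: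
      "\<And>\<omega> t. \<omega> \<in> space M \<Longrightarrow> t \<ge> 0 \<Longrightarrow> continuous (at_right t) (\<lambda>t. X t \<omega>)"
    and independent_increments:
      "\<And>(\<tau> :: nat \<Rightarrow> real) n. 0 \<le> \<tau> 0 \<Longrightarrow> mono \<tau> \<Longrightarrow>
         indep_vars (\<lambda>_. borel) (\<lambda>i \<omega>. X (\<tau> (Suc i)) \<omega> - X (\<tau> i) \<omega>) {..<n}"
    and stationary_increments:
      "\<And>s t. s \<ge> 0 \<Longrightarrow> t \<ge> 0 \<Longrightarrow>
         distr M borel (\<lambda>\<omega>. X (s + t) \<omega> - X s \<omega>) = distr M borel (X t)"
    and laplace_transform:
      "\<And>t \<mu>. t > 0 \<Longrightarrow> \<mu> > 0 \<Longrightarrow>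
         expectation (\<lambda>\<omega>. exp (- \<mu> * X t \<omega>)) = exp (- t * \<mu> powr \<alpha>)"

definition independent_processes ::
    "'a measure \<Rightarrow> (real \<Rightarrow> 'a \<Rightarrow> real) \<Rightarrow> (real \<Rightarrow> 'a \<Rightarrow> real) \<Rightarrow> bool" where
  "independent_processes M X Y \<longleftrightarrow>
     prob_space.indep_var M
       (Pi\<^sub>M {0..} (\<lambda>_. borel)) (\<lambda>\<omega>. \<lambda>t\<in>{0..}. X t \<omega>)
       (Pi\<^sub>M {0..} (\<lambda>_. borel)) (\<lambda>\<omega>. \<lambda>t\<in>{0..}. Y t \<omega>)"

(* Inf of the empty set of reals is unspecified; for the processes considered here
   the set is empty only on a null set. *)
definition inverse_process :: "(real \<Rightarrow> 'a \<Rightarrow> real) \<Rightarrow> real \<Rightarrow> 'a \<Rightarrow> real" where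
  "inverse_process X t \<omega> = Inf {s. s > 0 \<and> X s \<omega> \<ge> t}"

(* Densities of positive random variables are only determined almost everywhere; pointwise
   statements about them refer to the version that is continuous on the open half-line,
   which is unique once it is set to 0 off that half-line. *)
definition is_pdf :: "'a measure \<Rightarrow> ('a \<Rightarrow> real) \<Rightarrow> (real \<Rightarrow> real) \<Rightarrow> bool" where
  "is_pdf M X f \<longleftrightarrow>
     distributed M lborel X (\<lambda>x. ennreal (f x)) \<and> (\<forall>x. f x \<ge> 0) \<and>
     continuous_on {0<..} f \<and> (\<forall>x\<le>0. f x = 0)"

definition pdf :: "'a measure \<Rightarrow> ('a \<Rightarrow> real) \<Rightarrow> real \<Rightarrow> real" where
  "pdf M X = (THE f. is_pdf M X f)"

(* Class Gamma covers real and complex b.  At a pole of Gamma the summand is 0, because there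
   Gamma is 0 in the library and so is division by 0; this agrees with 1 / Gamma being entire. *)
definition Wright :: "real \<Rightarrow> 'b::Gamma \<Rightarrow> real \<Rightarrow> 'b" where
  "Wright a b x = (\<Sum>k. of_real x ^ k / (fact k * Gamma (of_real a * of_nat k + b)))"

end

theory Submission
  imports Defs "HOL-Complex_Analysis.Complex_Analysis"
begin

text \<open>
  The Laplace transform of a positive stable variable extends analytically to the right half-plane,
  hence determines the characteristic function, which is integrable; Levy inversion then gives a
  bounded continuous density. Rotating the inversion integral by a right angle and expanding
  the exponential of the fractional power turns this density into a Wright series.

  Since L(t) lies below x exactly when the subordinator at time x is above t (up to null sets), the
  densities of the inverse processes are derivatives in x of such probabilities.
  For the sum process the two summands are run at independent times x and y: the
  probability that their sum stays below t is a convolution which can be differentiated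
  in x or in y by putting the derivative on the corresponding distribution function, and the chain
  rule along y = 2 lam x produces the two terms of the formula. The Laplace transform in t of each
  convolution factorises.
\<close>

section \<open>Laplace transforms and characteristic functions\<close>

text \<open>A pointwise formula for a density needs a distinguished version, so absolute continuity
  alone is not enough: every density is produced together with its continuity. The inversion
  integral provides this, but on its original ray the terms u^(k \<alpha>) of an expansion are not
  integrable against the oscillating kernel. After the right-angle turn exp (- x v) supplies decay,
  each term is an Euler Gamma integral, and the reflection formula yields the reciprocal Gamma
  values of the Wright series. The condition \<alpha> < 1 makes cos (pi \<alpha> / 2) positive,
  hence the characteristic function integrable, and makes v^\<alpha> of lower order than v, hence
  the rotated kernel integrable.

  The constant 2 lam acts as a speed rather than a weight: by self-similarity (2 lam)^(1/\<nu>)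
  H2(s) is a \<nu>-stable variable at time 2 lam s. Hence the line y = 2 lam x, and the factor 2 lam
  of the second term is dy/dx. An inverse density is t / (\<alpha> x) times the subordinator density
  at t, so its Laplace transform comes from the derivative in \<mu> of the given one.\<close>

lemma exp_mult_lipschitz_right_half_plane:
  fixes w z :: complex and a y :: real
  assumes "a \<le> Re w" "a \<le> Re z" "0 \<le> y"
  shows "norm (exp (- (w * of_real y)) - exp (- (z * of_real y))) \<le> y * exp (- (a * y)) * norm (w - z)"
proof (rule field_differentiable_bound[where S = "{u. a \<le> Re u}"])
  show "convex {u. a \<le> Re u}" by (rule convex_halfspace_Re_ge)
  fix u :: complex assume u: "u \<in> {u. a \<le> Re u}"
  show "((\<lambda>u. exp (- (u * of_real y))) has_field_derivative - of_real y * exp (- (u * of_real y))) (at u within {u. a \<le> Re u})"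
    by (auto intro!: derivative_eq_intros)
  show "norm (- of_real y * exp (- (u * of_real y))) \<le> y * exp (- (a * y))"
    using u assms(3) by (auto simp: norm_mult intro!: mult_left_mono mult_right_mono)
qed (use assms in auto)

lemma mult_exp_minus_le:
  fixes a y :: real
  assumes "a > 0"
  shows "y * exp (- (a * y)) \<le> 1 / a"
proof -
  have "a * y \<le> exp (a * y)" using exp_ge_add_one_self[of "a*y"] by linarith
  then show ?thesis using assms by (simp add: exp_minus field_simps)
qed

text \<open>Differentiation under the expectation: the mean value bound on a half-plane dominates
  the difference quotients by the constant \<open>1 / a\<close>, so no moment of \<open>Y\<close>
  has to be finite. Used for analyticity and again for the expectation of X exp (- \<mu> X).\<close>

lemma (in prob_space) laplace_transform_has_field_derivative:
  fixes Y :: "'a \<Rightarrow> real" and z :: complex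
  assumes [measurable]: "random_variable borel Y" and pos: "\<And>\<omega>. \<omega> \<in> space M \<Longrightarrow> 0 \<le> Y \<omega>"
    and z: "0 < Re z"
  shows "((\<lambda>z. expectation (\<lambda>\<omega>. exp (- (z * of_real (Y \<omega>))))) has_field_derivative
     - expectation (\<lambda>\<omega>. of_real (Y \<omega>) * exp (- (z * of_real (Y \<omega>))))) (at z)"
proof -
  \<comment> \<open>Any number strictly between 0 and \<open>Re z\<close> serves: points near
    \<open>z\<close> stay in the half-plane \<open>a < Re w\<close>, where the quotients share one
    bound.\<close>
  define a where "a = Re z / 2"
  have a: "a > 0" "a < Re z" using z by (auto simp: a_def)
  define F where "F = (\<lambda>z. expectation (\<lambda>\<omega>. exp (- (z * complex_of_real (Y \<omega>)))))"
  have int: "integrable M (\<lambda>\<omega>. exp (- (w * complex_of_real (Y \<omega>))))" if "Re w \<ge> 0" for w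
    by (rule integrable_const_bound[where B = 1]) (use that pos in auto)
  have ev: "\<forall>\<^sub>F w in at z. a < Re w"
    using order_tendstoD(1)[OF tendsto_Re[OF tendsto_ident_at] a(2)] by simp
  have "((\<lambda>w. expectation (\<lambda>\<omega>. (exp (- (w * of_real (Y \<omega>))) - exp (- (z * of_real (Y \<omega>)))) / (w - z)))
      \<longlongrightarrow> expectation (\<lambda>\<omega>. - of_real (Y \<omega>) * exp (- (z * of_real (Y \<omega>))))) (at z)"
    unfolding tendsto_at_iff_sequentially comp_def
  proof safe
    fix X :: "nat \<Rightarrow> complex" assume X: "\<forall>i. X i \<in> UNIV - {z}" "X \<longlonglongrightarrow> z"
    have lim: "filterlim X (at z) sequentially"
      using X by (auto simp: filterlim_at)
    have "\<forall>\<^sub>F i in sequentially. a < Re (X i)"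
      using ev lim by (auto simp: filterlim_iff)
    then obtain N where N: "\<And>i. i \<ge> N \<Longrightarrow> a < Re (X i)" by (auto simp: eventually_sequentially)
    \<comment> \<open>Dominated convergence needs the bound at every index, so the sequence starts
      at \<open>N\<close>; \<open>LIMSEQ_offset\<close> removes the shift.\<close>
    have "(\<lambda>i. expectation (\<lambda>\<omega>. (exp (- (X (i + N) * of_real (Y \<omega>))) - exp (- (z * of_real (Y \<omega>)))) / (X (i + N) - z)))
      \<longlonglongrightarrow> expectation (\<lambda>\<omega>. - of_real (Y \<omega>) * exp (- (z * of_real (Y \<omega>))))"
    proof (rule integral_dominated_convergence[where w = "\<lambda>_. 1 / a"])
      show "AE \<omega> in M. (\<lambda>i. (exp (- (X (i + N) * of_real (Y \<omega>))) - exp (- (z * of_real (Y \<omega>)))) / (X (i + N) - z))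
         \<longlonglongrightarrow> - of_real (Y \<omega>) * exp (- (z * of_real (Y \<omega>)))"
      proof (rule AE_I2)
        fix \<omega>
        have "((\<lambda>u. exp (- (u * of_real (Y \<omega>)))) has_field_derivative - of_real (Y \<omega>) * exp (- (z * of_real (Y \<omega>)))) (at z)"
          by (auto intro!: derivative_eq_intros)
        then have "((\<lambda>u. (exp (- (u * of_real (Y \<omega>))) - exp (- (z * of_real (Y \<omega>)))) / (u - z)) \<longlongrightarrow> - of_real (Y \<omega>) * exp (- (z * of_real (Y \<omega>)))) (at z)"
          by (simp add: has_field_derivative_iff)
        from LIMSEQ_ignore_initial_segment[OF filterlim_compose[OF this lim], of N]
        show "(\<lambda>i. (exp (- (X (i + N) * of_real (Y \<omega>))) - exp (- (z * of_real (Y \<omega>)))) / (X (i + N) - z))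
         \<longlonglongrightarrow> - of_real (Y \<omega>) * exp (- (z * of_real (Y \<omega>)))"
          by simp
      qed
      show "AE \<omega> in M. norm ((exp (- (X (i + N) * of_real (Y \<omega>))) - exp (- (z * of_real (Y \<omega>)))) / (X (i + N) - z)) \<le> 1 / a" for i
      proof (rule AE_I2)
        fix \<omega> assume \<omega>: "\<omega> \<in> space M"
        have "norm (exp (- (X (i + N) * of_real (Y \<omega>))) - exp (- (z * of_real (Y \<omega>)))) \<le> Y \<omega> * exp (- (a * Y \<omega>)) * norm (X (i + N) - z)"
          using N[of "i+N"] a pos[OF \<omega>] by (intro exp_mult_lipschitz_right_half_plane) auto
        also have "\<dots> \<le> 1 / a * norm (X (i + N) - z)"
          by (intro mult_right_mono mult_exp_minus_le a) auto
        finally show "norm ((exp (- (X (i + N) * of_real (Y \<omega>))) - exp (- (z * of_real (Y \<omega>)))) / (X (i + N) - z)) \<le> 1 / a"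
          using X(1) by (auto simp: norm_divide divide_le_eq)
      qed
    qed auto
    then show "(\<lambda>i. expectation (\<lambda>\<omega>. (exp (- (X i * of_real (Y \<omega>))) - exp (- (z * of_real (Y \<omega>)))) / (X i - z)))
      \<longlonglongrightarrow> expectation (\<lambda>\<omega>. - of_real (Y \<omega>) * exp (- (z * of_real (Y \<omega>))))"
      by (rule LIMSEQ_offset)
  qed
  moreover have "\<forall>\<^sub>F w in at z. expectation (\<lambda>\<omega>. (exp (- (w * of_real (Y \<omega>))) - exp (- (z * of_real (Y \<omega>)))) / (w - z)) = (F w - F z) / (w - z)"
    using ev
  proof eventually_elim
    case (elim w)
    then show ?case using a z
      unfolding F_def by (subst Bochner_Integration.integral_diff[symmetric]) (auto intro!: int)
  qed
  ultimately have "((\<lambda>w. (F w - F z) / (w - z)) \<longlongrightarrow> expectation (\<lambda>\<omega>. - of_real (Y \<omega>) * exp (- (z * of_real (Y \<omega>))))) (at z)"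
    by (rule Lim_transform_eventually)
  then show ?thesis unfolding F_def by (simp add: has_field_derivative_iff)
qed

text \<open>The unit-time law, detached from any process. Self-similarity brings every other time
  back to it, so the Fourier analysis is done once.\<close>

locale positive_stable = prob_space M for M :: "'a measure" +
  fixes \<alpha> :: real and Y :: "'a \<Rightarrow> real"
  assumes \<alpha>: "0 < \<alpha>" "\<alpha> < 1"
    and rv[measurable]: "random_variable borel Y"
    and nonneg: "\<And>\<omega>. \<omega> \<in> space M \<Longrightarrow> 0 \<le> Y \<omega>"
    and laplace: "\<And>\<mu>. \<mu> > 0 \<Longrightarrow> expectation (\<lambda>\<omega>. exp (- \<mu> * Y \<omega>)) = exp (- (\<mu> powr \<alpha>))"
begin

text \<open>Identity theorem: both sides are holomorphic for \<open>0 < Re z\<close> and agree on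
  the positive reals, which accumulate at the interior point 1.\<close>

lemma laplace_complex:
  assumes z: "0 < Re z"
  shows "expectation (\<lambda>\<omega>. exp (- (z * of_real (Y \<omega>)))) = exp (- (z powr of_real \<alpha>))"
proof -
  define S where "S = {z::complex. 0 < Re z}"
  define U where "U = complex_of_real ` {0<..}"
  define F where "F = (\<lambda>z. expectation (\<lambda>\<omega>. exp (- (z * complex_of_real (Y \<omega>)))) - exp (- (z powr of_real \<alpha>)))"
  have "F z = 0"
  proof (rule analytic_continuation[of F S U 1 z])
    have "(\<lambda>z. expectation (\<lambda>\<omega>. exp (- (z * complex_of_real (Y \<omega>))))) holomorphic_on S"
      using laplace_transform_has_field_derivative[OF rv nonneg]
      by (auto simp: S_def holomorphic_on_def field_differentiable_def intro: has_field_derivative_at_within)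
    then show "F holomorphic_on S"
      unfolding F_def by (rule holomorphic_on_diff) (auto intro!: holomorphic_intros simp: S_def complex_nonpos_Reals_iff)
    show "open S" "connected S"
      by (auto simp: S_def open_halfspace_Re_gt intro!: convex_connected convex_halfspace_Re_gt)
    show "1 islimpt U"
      unfolding islimpt_approachable
    proof safe
      fix e :: real assume "e > 0"
      then show "\<exists>x'\<in>U. x' \<noteq> 1 \<and> dist x' 1 < e"
        by (intro bexI[of _ "complex_of_real (1 + e/2)"])
           (auto simp: U_def dist_norm complex_eq_iff simp del: of_real_add intro!: imageI, simp add: norm_divide)
    qed
    fix w assume "w \<in> U"
    then obtain \<mu> where \<mu>: "w = of_real \<mu>" "\<mu> > 0" by (auto simp: U_def)
    have "expectation (\<lambda>\<omega>. exp (- (w * complex_of_real (Y \<omega>)))) = expectation (\<lambda>\<omega>. complex_of_real (exp (- \<mu> * Y \<omega>)))"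
      by (simp add: \<mu> exp_of_real[symmetric])
    also have "\<dots> = of_real (exp (- (\<mu> powr \<alpha>)))"
      using laplace[OF \<mu>(2)] by (simp only: integral_complex_of_real)
    also have "\<dots> = exp (- (w powr of_real \<alpha>))"
    proof -
      have "w powr of_real \<alpha> = of_real (\<mu> powr \<alpha>)"
        unfolding \<mu>(1) by (rule powr_of_real) (use \<mu>(2) in simp)
      then show ?thesis by (metis exp_of_real of_real_minus)
    qed
    finally show "F w = 0" by (simp add: F_def)
  qed (use z in \<open>auto simp: S_def U_def\<close>)
  then show ?thesis by (simp add: F_def)
qed

end

text \<open>Boundary value of exp (- z^\<alpha>) at z = - i u. At u = 0 the convention
  \<open>0 powr a = 0\<close> gives the correct value 1.\<close>

definition stable_char :: "real \<Rightarrow> real \<Rightarrow> complex" where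
  "stable_char \<alpha> u = exp (- ((- (\<i> * of_real u)) powr of_real \<alpha>))"

text \<open>The argument of - i u is -pi/2 or pi/2 according to the sign of u. So the power has real
  part |u|^\<alpha> cos (pi \<alpha> / 2), the source of the decay in u.\<close>

lemma powr_imaginary_axis:
  "0 < u \<Longrightarrow> (- (\<i> * complex_of_real u)) powr of_real \<alpha> = of_real (u powr \<alpha>) * cis (- (pi * \<alpha> / 2))"
  "u < 0 \<Longrightarrow> (- (\<i> * complex_of_real u)) powr of_real \<alpha> = of_real (\<bar>u\<bar> powr \<alpha>) * cis (pi * \<alpha> / 2)"
proof -
  assume u: "0 < u"
  have L: "Ln (- (\<i> * complex_of_real u)) = of_real (ln u) - \<i> * pi / 2"
  proof -
    have "Ln (- (\<i> * complex_of_real u)) = Ln (of_real u * - \<i>)" by (simp add: mult.commute)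
    also have "\<dots> = of_real (ln u) - \<i> * pi / 2"
      using u by (subst Ln_times_of_real) (auto simp: Ln_of_real)
    finally show ?thesis .
  qed
  show "(- (\<i> * complex_of_real u)) powr of_real \<alpha> = of_real (u powr \<alpha>) * cis (- (pi * \<alpha> / 2))"
    using u by (simp add: powr_def L cis_conv_exp exp_of_real[symmetric] exp_add[symmetric] algebra_simps)
next
  assume u: "u < 0"
  have L: "Ln (- (\<i> * complex_of_real u)) = of_real (ln \<bar>u\<bar>) + \<i> * pi / 2"
  proof -
    have "Ln (- (\<i> * complex_of_real u)) = Ln (of_real \<bar>u\<bar> * \<i>)" using u by (simp add: mult.commute)
    also have "\<dots> = of_real (ln \<bar>u\<bar>) + \<i> * pi / 2"
      using u by (subst Ln_times_of_real) (use Ln_of_real[of "-u"] in auto)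
    finally show ?thesis .
  qed
  show "(- (\<i> * complex_of_real u)) powr of_real \<alpha> = of_real (\<bar>u\<bar> powr \<alpha>) * cis (pi * \<alpha> / 2)"
    using u by (simp add: powr_def L cis_conv_exp exp_of_real[symmetric] exp_add[symmetric] algebra_simps)
qed

lemma norm_stable_char:
  "norm (stable_char \<alpha> u) = exp (- (\<bar>u\<bar> powr \<alpha> * cos (pi * \<alpha> / 2)))"
  using powr_imaginary_axis[of u \<alpha>]
  by (cases u "0::real" rule: linorder_cases) (auto simp: stable_char_def)

lemma continuous_on_stable_char:
  assumes "0 < \<alpha>"
  shows "continuous_on UNIV (stable_char \<alpha>)"
proof -
  have "isCont (stable_char \<alpha>) u" if "u \<noteq> 0" for u
    using that unfolding stable_char_def
    by (intro continuous_intros) (auto simp: complex_nonpos_Reals_iff)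
  \<comment> \<open>At the branch point 0 continuity comes from the modulus |u|^\<alpha> of the
    power tending to 0.\<close>
  moreover have "isCont (stable_char \<alpha>) 0"
  proof -
    have "((\<lambda>u::real. (- (\<i> * complex_of_real u)) powr of_real \<alpha>) \<longlongrightarrow> 0) (at 0)"
    proof (rule tendsto_norm_zero_cancel)
      have "((\<lambda>u. \<bar>u\<bar> powr \<alpha>) \<longlongrightarrow> \<bar>0\<bar> powr \<alpha>) (at (0::real))"
        using assms by (intro tendsto_powr' tendsto_intros) auto
      moreover have "norm ((- (\<i> * complex_of_real u)) powr of_real \<alpha>) = \<bar>u\<bar> powr \<alpha>" for u
        using powr_imaginary_axis[of u \<alpha>]
        by (cases u "0::real" rule: linorder_cases) (auto simp: norm_mult)
      ultimately show "((\<lambda>u::real. norm ((- (\<i> * complex_of_real u)) powr of_real \<alpha>)) \<longlongrightarrow> 0) (at 0)"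
        by simp
    qed
    then show ?thesis using assms unfolding isCont_def stable_char_def
      by (auto intro!: tendsto_eq_intros)
  qed
  ultimately have "isCont (stable_char \<alpha>) u" for u by (cases "u = 0") auto
  then show ?thesis by (simp add: continuous_at_imp_continuous_on)
qed

lemma (in positive_stable) char_eq:
  "char (distr M borel Y) u = stable_char \<alpha> u"
proof (cases "u = 0")
  case True
  interpret D: prob_space "distr M borel Y" by (rule prob_space_distr) simp
  interpret D: real_distribution "distr M borel Y" by unfold_locales auto
  show ?thesis using True by (simp add: stable_char_def D.char_zero)
next
  case False
  \<comment> \<open>The Laplace formula is known only inside the half-plane; these points approach
    the imaginary axis from there, with all integrands bounded by 1.\<close>
  define z where "z = (\<lambda>n. complex_of_real (inverse (real (Suc n))) - \<i> * of_real u)"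
  have z: "0 < Re (z n)" for n by (simp add: z_def)
  have lim: "z \<longlonglongrightarrow> of_real 0 - \<i> * of_real u"
    unfolding z_def by (intro tendsto_intros LIMSEQ_inverse_real_of_nat)
  have "(\<lambda>n. expectation (\<lambda>\<omega>. exp (- (z n * of_real (Y \<omega>))))) \<longlonglongrightarrow> expectation (\<lambda>\<omega>. exp (- ((of_real 0 - \<i> * of_real u) * of_real (Y \<omega>))))"
  proof (rule integral_dominated_convergence[where w = "\<lambda>_. 1"])
    show "AE \<omega> in M. (\<lambda>n. exp (- (z n * of_real (Y \<omega>)))) \<longlonglongrightarrow> exp (- ((of_real 0 - \<i> * of_real u) * of_real (Y \<omega>)))"
      by (intro AE_I2 tendsto_intros lim)
    show "AE \<omega> in M. norm (exp (- (z n * of_real (Y \<omega>)))) \<le> 1" for n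
      using z[of n] nonneg by (intro AE_I2) auto
  qed auto
  moreover have "(\<lambda>n. exp (- (z n powr of_real \<alpha>))) \<longlonglongrightarrow> exp (- ((of_real 0 - \<i> * of_real u) powr of_real \<alpha>))"
    using False by (intro tendsto_intros lim) (auto simp: complex_nonpos_Reals_iff)
  ultimately have "expectation (\<lambda>\<omega>. exp (- ((of_real 0 - \<i> * of_real u) * of_real (Y \<omega>)))) = exp (- ((of_real 0 - \<i> * of_real u) powr of_real \<alpha>))"
    unfolding laplace_complex[OF z] by (rule LIMSEQ_unique)
  then show ?thesis
    by (simp add: char_def stable_char_def integral_distr mult.assoc)
qed

section \<open>The density of a positive stable variable\<close>

text \<open>The weight \<open>1 + x\<^sup>2\<close> makes the majorant a multiple of the integrable
  1 / (1 + x^2); on the compact middle range continuity supplies the constant.\<close>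

lemma integrable_continuous_decay:
  fixes f :: "real \<Rightarrow> real"
  assumes cont: "continuous_on UNIV f"
    and top: "((\<lambda>x. (1 + x\<^sup>2) * f x) \<longlongrightarrow> 0) at_top" and bot: "((\<lambda>x. (1 + x\<^sup>2) * f x) \<longlongrightarrow> 0) at_bot"
  shows "integrable lborel f"
proof -
  have "\<forall>\<^sub>F x in at_top. norm ((1 + x\<^sup>2) * f x) < 1"
    using order_tendstoD(2)[OF tendsto_norm[OF top], of 1] by simp
  then obtain A where A: "\<And>x. x \<ge> A \<Longrightarrow> norm ((1 + x\<^sup>2) * f x) < 1"
    by (auto simp: eventually_at_top_linorder)
  have "\<forall>\<^sub>F x in at_bot. norm ((1 + x\<^sup>2) * f x) < 1"
    using order_tendstoD(2)[OF tendsto_norm[OF bot], of 1] by simp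
  then obtain B where B: "\<And>x. x \<le> B \<Longrightarrow> norm ((1 + x\<^sup>2) * f x) < 1"
    by (auto simp: eventually_at_bot_linorder)
  have "compact ((\<lambda>x. (1 + x\<^sup>2) * f x) ` {B..A})"
    by (intro compact_continuous_image continuous_intros continuous_on_subset[OF cont]) auto
  then have "bounded ((\<lambda>x. (1 + x\<^sup>2) * f x) ` {B..A})" by (rule compact_imp_bounded)
  then obtain C where "\<forall>y\<in>(\<lambda>x. (1 + x\<^sup>2) * f x) ` {B..A}. norm y \<le> C" unfolding bounded_iff by blast
  then have C: "norm ((1 + x\<^sup>2) * f x) \<le> C" if "x \<in> {B..A}" for x using that by blast
  define K where "K = max 1 C"
  have K: "norm ((1 + x\<^sup>2) * f x) \<le> K" for x
  proof -
    consider "x \<ge> A" | "x \<le> B" | "B \<le> x" "x \<le> A" by linarith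
    then show ?thesis
    proof cases
      case 1 then show ?thesis using A[of x] by (simp add: K_def)
    next
      case 2 then show ?thesis using B[of x] by (simp add: K_def)
    next
      case 3 then show ?thesis using C[of x] by (simp add: K_def)
    qed
  qed
  show ?thesis
  proof (rule Bochner_Integration.integrable_bound)
    show "integrable lborel (\<lambda>x::real. K * inverse (1 + x\<^sup>2))"
      using integrable_inverse_1_plus_square by (intro integrable_mult_right) (simp add: set_integrable_def)
    show "f \<in> borel_measurable lborel" using cont by (simp add: borel_measurable_continuous_onI)
    show "AE x in lborel. norm (f x) \<le> norm (K * inverse (1 + x\<^sup>2))"
    proof (rule AE_I2)
      fix x :: real
      have p: "1 + x\<^sup>2 > 0" by (simp add: add_pos_nonneg)
      then have "norm (f x) * (1 + x\<^sup>2) \<le> K" using K[of x] by (simp add: abs_mult mult.commute)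
      then have "norm (f x) \<le> K / (1 + x\<^sup>2)" using p by (simp add: field_simps)
      also have "\<dots> \<le> norm (K * inverse (1 + x\<^sup>2))" by (simp add: divide_inverse)
      finally show "norm (f x) \<le> norm (K * inverse (1 + x\<^sup>2))" .
    qed
  qed
qed

section \<open>Fourier inversion and absence of atoms\<close>

lemma integrable_stable_char:
  assumes "0 < \<alpha>" "\<alpha> < 1"
  shows "integrable lborel (stable_char \<alpha>)"
proof -
  define c where "c = cos (pi * \<alpha> / 2)"
  \<comment> \<open>\<alpha> < 1 keeps the angle pi \<alpha> / 2 below pi/2, so \<open>c\<close> is
    positive and the modulus decays like a stretched exponential.\<close>
  have "pi * \<alpha> < pi * 1" using assms by (intro mult_strict_left_mono) auto
  then have c: "c > 0" unfolding c_def using assms by (intro cos_gt_zero) auto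
  have "integrable lborel (\<lambda>u. exp (- (\<bar>u\<bar> powr \<alpha> * c)))"
  proof (rule integrable_continuous_decay)
    have "((\<lambda>u::real. (1 + u\<^sup>2) * exp (- (u powr \<alpha> * c))) \<longlongrightarrow> 0) at_top"
      using c assms by real_asymp
    then show "((\<lambda>u::real. (1 + u\<^sup>2) * exp (- (\<bar>u\<bar> powr \<alpha> * c))) \<longlongrightarrow> 0) at_top"
      by (rule Lim_transform_eventually) (auto intro!: eventually_mono[OF eventually_ge_at_top[of 0]])
    then show "((\<lambda>u::real. (1 + u\<^sup>2) * exp (- (\<bar>u\<bar> powr \<alpha> * c))) \<longlongrightarrow> 0) at_bot"
      by (simp add: filterlim_at_bot_mirror)
  qed (intro continuous_on_exp continuous_on_minus continuous_on_mult continuous_on_const continuous_on_powr' continuous_on_rabs continuous_on_id; use assms in auto)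
  then show ?thesis
    by (rule Bochner_Integration.integrable_bound)
       (auto simp: norm_stable_char c_def continuous_on_stable_char assms intro!: borel_measurable_continuous_onI)
qed

text \<open>The Fourier inversion integral. It is real already, because u \<mapsto> - u conjugates
  the integrand; \<open>Re\<close> only changes the type.\<close>

definition stable_density :: "real \<Rightarrow> real \<Rightarrow> real" where
  "stable_density \<alpha> x = Re (CLINT u|lborel. iexp (- (u * x)) * stable_char \<alpha> u) / (2 * pi)"

lemma continuous_on_stable_density:
  assumes "0 < \<alpha>" "\<alpha> < 1"
  shows "continuous_on UNIV (stable_density \<alpha>)"
proof -
  have [measurable]: "stable_char \<alpha> \<in> borel_measurable borel"
    using assms by (auto intro!: borel_measurable_continuous_onI continuous_on_stable_char)
  have "isCont (\<lambda>x. CLINT u|lborel. iexp (- (u * x)) * stable_char \<alpha> u) x" for x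
    unfolding continuous_at_sequentially comp_def
  proof safe
    fix X assume X: "X \<longlonglongrightarrow> x"
    show "(\<lambda>n. CLINT u|lborel. iexp (- (u * X n)) * stable_char \<alpha> u) \<longlonglongrightarrow> (CLINT u|lborel. iexp (- (u * x)) * stable_char \<alpha> u)"
    proof (rule integral_dominated_convergence[where w = "\<lambda>u. norm (stable_char \<alpha> u)"])
      show "integrable lborel (\<lambda>u. norm (stable_char \<alpha> u))"
        using integrable_stable_char[OF assms] by simp
      show "AE u in lborel. (\<lambda>n. iexp (- (u * X n)) * stable_char \<alpha> u) \<longlonglongrightarrow> iexp (- (u * x)) * stable_char \<alpha> u"
        by (intro AE_I2 tendsto_intros X)
    qed (auto simp: norm_mult)
  qed
  then show ?thesis unfolding stable_density_def
    by (auto intro!: continuous_intros continuous_at_imp_continuous_on)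
qed

text \<open>The kernel in Levy's formula is the integral of \<open>iexp (- (t * x))\<close> over
  [a, b], and integrability of \<open>stable_char\<close> lets Fubini exchange it with the
  t-integral. Levy's formula needs endpoints that are not atoms; \<open>measure_singleton\<close>
  later shows that all points qualify.\<close>

lemma (in positive_stable) stable_density_interval_nonatom:
  fixes a b :: real
  assumes "a \<le> b" "measure (distr M borel Y) {a} = 0" "measure (distr M borel Y) {b} = 0"
  shows "measure (distr M borel Y) {a<..b} = (LBINT x=a..b. stable_density \<alpha> x)"
proof -
  interpret D: prob_space "distr M borel Y" by (rule prob_space_distr) simp
  interpret D: real_distribution "distr M borel Y" by unfold_locales auto
  have [measurable]: "stable_char \<alpha> \<in> borel_measurable borel"
    using \<alpha> by (auto intro!: borel_measurable_continuous_onI continuous_on_stable_char)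
  \<comment> \<open>At t = 0 division by zero gives 0 instead of the limit b - a; the comparison of
    integrals below is only almost everywhere.\<close>
  define G where "G = (\<lambda>t. (iexp (- (t * a)) - iexp (- (t * b))) / (\<i> * t) * stable_char \<alpha> t)"
  have G: "G t = (CLBINT x=a..b. iexp (- (t * x)) * stable_char \<alpha> t)" if "t \<noteq> 0" for t
  proof -
    have "(CLBINT x=a..b. iexp (- (t * x)) * stable_char \<alpha> t) = \<i> / t * iexp (- (t * b)) * stable_char \<alpha> t - \<i> / t * iexp (- (t * a)) * stable_char \<alpha> t"
    proof (rule interval_integral_FTC_finite)
      show "continuous_on {min a b..max a b} (\<lambda>x. iexp (- (t * x)) * stable_char \<alpha> t)"
        by (auto intro!: continuous_intros)
      show "((\<lambda>x. \<i> / t * iexp (- (t * x)) * stable_char \<alpha> t) has_vector_derivative iexp (- (t * x)) * stable_char \<alpha> t) (at x within {min a b..max a b})" for x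
      proof -
        have "((\<lambda>z. \<i> / t * exp (\<i> * (- (t * z))) * stable_char \<alpha> t) has_field_derivative iexp (- (t * x)) * stable_char \<alpha> t) (at (of_real x))"
          using that by (auto intro!: derivative_eq_intros simp: field_simps)
        from has_vector_derivative_real_field[OF this] show ?thesis by simp
      qed
    qed
    also have "\<dots> = G t" using that by (simp add: G_def field_simps)
    finally show ?thesis by simp
  qed
  have bound: "norm (G t) \<le> (b - a) * norm (stable_char \<alpha> t)" for t
  proof (cases "t = 0")
    case False
    have "norm ((iexp (t * - a) - iexp (t * - b)) / (\<i> * t)) \<le> - a - - b"
      using assms(1) False by (intro Levy_Inversion_aux2) auto
    then show ?thesis unfolding G_def norm_mult by (intro mult_right_mono) (auto simp: )
  qed (use assms(1) in \<open>simp add: G_def\<close>)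
  have intG: "integrable lborel G"
    by (rule Bochner_Integration.integrable_bound[of _ "\<lambda>t. (b - a) * norm (stable_char \<alpha> t)"])
       (use bound \<alpha> assms(1) in \<open>auto simp: G_def abs_mult intro!: integrable_mult_right integrable_norm integrable_stable_char\<close>)
  \<comment> \<open>Levy's truncated integrals converge to a full Lebesgue integral because
    \<open>G\<close> is integrable.\<close>
  have "(\<lambda>n. 1 / (2 * pi) * (CLBINT t=-real n..real n. G t)) \<longlonglongrightarrow> 1 / (2 * pi) * (CLINT t|lborel. G t)"
  proof (intro tendsto_intros)
    have "(\<lambda>n. CLINT t|lborel. indicator {- real n<..<real n} t *\<^sub>R G t) \<longlonglongrightarrow> (CLINT t|lborel. G t)"
    proof (rule integral_dominated_convergence[where w = "\<lambda>t. norm (G t)"])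
      show "AE t in lborel. (\<lambda>n. indicator {- real n<..<real n} t *\<^sub>R G t) \<longlonglongrightarrow> G t"
      proof (intro AE_I2 tendsto_eventually)
        fix t :: real
        show "\<forall>\<^sub>F n in sequentially. indicator {- real n<..<real n} t *\<^sub>R G t = G t"
          using eventually_gt_at_top[of "nat \<lceil>\<bar>t\<bar>\<rceil>"]
          by eventually_elim (auto simp: indicator_def, linarith+)
      qed
    qed (use intG in \<open>auto simp: indicator_def G_def\<close>)
    then show "(\<lambda>n. CLBINT t=-real n..real n. G t) \<longlonglongrightarrow> (CLINT t|lborel. G t)"
      by (simp add: interval_lebesgue_integral_le_eq set_lebesgue_integral_def)
  qed
  moreover have "(\<lambda>n. 1 / (2 * pi) * (CLBINT t=-real n..real n. G t)) \<longlonglongrightarrow> measure (distr M borel Y) {a<..b}"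
    using D.Levy_Inversion[OF assms] by (simp only: char_eq G_def of_int_minus of_int_of_nat_eq)
  ultimately have meas: "measure (distr M borel Y) {a<..b} = 1 / (2 * pi) * (CLINT t|lborel. G t)"
    using LIMSEQ_unique by blast
  define K where "K = (\<lambda>x. CLINT t|lborel. iexp (- (t * x)) * stable_char \<alpha> t)"
  define f where "f = (\<lambda>x t. indicator {a..b} x *\<^sub>R (iexp (- (t * x)) * stable_char \<alpha> t))"
  have int_f: "integrable (lborel \<Otimes>\<^sub>M lborel) (\<lambda>(x, t). f x t)"
  proof (rule lborel_pair.Fubini_integrable)
    show "(\<lambda>(x, t). f x t) \<in> borel_measurable (lborel \<Otimes>\<^sub>M lborel)"
      unfolding f_def by measurable
    have "integrable lborel (\<lambda>x. indicator {a..b} x * (LBINT t. norm (stable_char \<alpha> t)))"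
      using emeasure_lborel_Icc[OF assms(1)] by (intro integrable_mult_left integrable_real_indicator) auto
    then show "integrable lborel (\<lambda>x. LBINT t. norm (case (x, t) of (x, t) \<Rightarrow> f x t))"
      by (simp add: f_def norm_mult)
    show "AE x in lborel. integrable lborel (\<lambda>t. case (x, t) of (x, t) \<Rightarrow> f x t)"
    proof (rule AE_I2)
      fix x
      have "integrable lborel (f x)"
        by (rule Bochner_Integration.integrable_bound[OF integrable_stable_char[OF \<alpha>]])
           (auto simp: f_def norm_mult indicator_def)
      then show "integrable lborel (\<lambda>t. case (x, t) of (x, t) \<Rightarrow> f x t)" by simp
    qed
  qed
  have "(CLINT t|lborel. G t) = (CLINT t|lborel. CLINT x|lborel. f x t)"
  proof (rule integral_cong_AE)
    have "AE t in lborel. t \<noteq> (0::real)" by (rule AE_lborel_singleton)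
    then show "AE t in lborel. G t = (CLINT x|lborel. f x t)"
    proof eventually_elim
      case (elim t)
      then show ?case using assms(1)
        by (simp only: G interval_integral_Icc set_lebesgue_integral_def f_def not_False_eq_True)
    qed
  qed (auto simp: G_def f_def)
  also have "\<dots> = (CLINT x|lborel. CLINT t|lborel. f x t)"
    by (rule lborel_pair.Fubini_integral[OF int_f])
  also have "\<dots> = (CLINT x|lborel. indicator {a..b} x *\<^sub>R K x)"
    by (simp add: f_def K_def)
  finally have "measure (distr M borel Y) {a<..b} = Re (1 / (2 * pi) * (CLINT x|lborel. indicator {a..b} x *\<^sub>R K x))"
    using meas by (metis Re_complex_of_real)
  also have "\<dots> = (LBINT x. Re (indicator {a..b} x *\<^sub>R K x)) / (2 * pi)"
  proof -
    have "integrable lborel (\<lambda>x. indicator {a..b} x *\<^sub>R K x)"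
      using lborel_pair.integrable_fst'[OF int_f] by (simp add: f_def K_def)
    from integral_Re[OF this] show ?thesis by simp
  qed
  also have "\<dots> = (LBINT x=a..b. stable_density \<alpha> x)"
    using assms(1) by (simp add: interval_integral_Icc set_lebesgue_integral_def stable_density_def K_def)
  finally show ?thesis .
qed

text \<open>Atoms are countable, so x can be enclosed between non-atomic points arbitrarily close to
  it; as \<open>stable_density\<close> is bounded, the interval formula makes the enclosed mass
  arbitrarily small.\<close>

lemma (in positive_stable) measure_singleton:
  "measure (distr M borel Y) {x} = 0"
proof -
  interpret D: prob_space "distr M borel Y" by (rule prob_space_distr) simp
  interpret D: real_distribution "distr M borel Y" by unfold_locales auto
  have [measurable]: "stable_density \<alpha> \<in> borel_measurable borel"
    using \<alpha> by (auto intro!: borel_measurable_continuous_onI continuous_on_stable_density)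
  define C where "C = (LBINT u. norm (stable_char \<alpha> u)) / (2 * pi)"
  have C: "\<bar>stable_density \<alpha> y\<bar> \<le> C" for y
  proof -
    have "\<bar>Re (CLINT u|lborel. iexp (- (u * y)) * stable_char \<alpha> u)\<bar> \<le> norm (CLINT u|lborel. iexp (- (u * y)) * stable_char \<alpha> u)"
      by (rule abs_Re_le_cmod)
    also have "\<dots> \<le> (LBINT u. norm (iexp (- (u * y)) * stable_char \<alpha> u))"
      by (rule integral_norm_bound)
    finally show ?thesis by (simp add: stable_density_def C_def norm_mult divide_right_mono)
  qed
  have "measure (distr M borel Y) {x} \<le> 0 + e" if "e > 0" for e
  proof -
    have "C \<ge> 0" using C[of 0] by linarith
    \<comment> \<open>The interval is shorter than 2 d, so its mass is at most 2 d C; the added 1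
      keeps the denominator positive when \<open>C\<close> is 0.\<close>
    define d where "d = e / (2 * (C + 1))"
    have d: "d > 0" using \<open>C \<ge> 0\<close> that by (simp add: d_def)
    obtain a where a: "a \<in> {x-d<..<x}" "measure (distr M borel Y) {a} = 0"
      using real_interval_avoid_countable_set[OF _ D.countable_atoms, of "x-d" x] d
      by (metis (mono_tags, lifting) diff_less_eq less_add_same_cancel1 measure_nonneg mem_Collect_eq order_less_le)
    obtain b where b: "b \<in> {x<..<x+d}" "measure (distr M borel Y) {b} = 0"
      using real_interval_avoid_countable_set[OF _ D.countable_atoms, of x "x+d"] d
      by (metis (mono_tags, lifting) less_add_same_cancel1 measure_nonneg mem_Collect_eq order_less_le)
    have "measure (distr M borel Y) {x} \<le> measure (distr M borel Y) {a<..b}"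
      using a b by (intro D.finite_measure_mono) auto
    also have "\<dots> = (LBINT x:{a..b}. stable_density \<alpha> x)"
      using a b by (subst stable_density_interval_nonatom) (auto simp: interval_integral_Icc)
    also have "\<dots> \<le> (LBINT x:{a..b}. C)"
      using C by (intro set_integral_mono borel_integrable_atLeastAtMost' continuous_on_subset[OF continuous_on_stable_density] \<alpha>)
        (auto simp: abs_le_iff)
    also have "\<dots> = (b - a) * C" using a b by (simp add: set_lebesgue_integral_def)
    also have "\<dots> \<le> (2 * d) * C" using a b \<open>C \<ge> 0\<close> by (intro mult_right_mono) auto
    also have "\<dots> \<le> e" using \<open>C \<ge> 0\<close> that by (simp add: d_def field_simps)
    finally show ?thesis by simp
  qed
  then have "measure (distr M borel Y) {x} \<le> 0" by (rule field_le_epsilon)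
  then show ?thesis by (simp add: measure_le_0_iff)
qed

text \<open>The fundamental theorem for nonnegative derivatives gives the tail \<open>{x<..}\<close>
  the mass \<open>1 - cdf D x\<close>, and tails determine the measure. At 0 right continuity of the
  distribution function is enough, so densities that jump there, as those of inverse processes do,
  are covered.\<close>

lemma real_distribution_eq_density:
  assumes "real_distribution D"
    and f: "\<And>x. 0 < x \<Longrightarrow> (cdf D has_real_derivative f x) (at x)" "continuous_on {0<..} f"
      "\<And>x. 0 \<le> f x" "\<And>x. x \<le> 0 \<Longrightarrow> f x = 0"
    and cdf0: "cdf D 0 = 0"
  shows "D = density lborel (\<lambda>x. ennreal (f x))" "f \<in> borel_measurable borel"
proof -
  interpret D: real_distribution D by fact
  have "(\<lambda>x. indicator {0<..} x *\<^sub>R f x) \<in> borel_measurable borel"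
    using f(2) by (intro borel_measurable_continuous_on_indicator) auto
  also have "(\<lambda>x. indicator {0<..} x *\<^sub>R f x) = f" using f(4) by (force simp: indicator_def)
  finally show [measurable]: "f \<in> borel_measurable borel" .
  have tail: "emeasure (density lborel (\<lambda>x. ennreal (f x))) {x<..} = ennreal (1 - cdf D x)" if "0 \<le> x" for x
  proof -
    have *: "set_integrable lborel (einterval (ereal x) \<infinity>) f" "(LBINT y=ereal x..\<infinity>. f y) = 1 - cdf D x"
    proof (rule_tac [!] interval_integral_FTC_nonneg)
      show "((cdf D \<circ> real_of_ereal) \<longlongrightarrow> cdf D x) (at_right (ereal x))"
        using D.cdf_is_right_cont[of x] by (simp add: ereal_tendsto_simps continuous_within)
      then show "((cdf D \<circ> real_of_ereal) \<longlongrightarrow> cdf D x) (at_right (ereal x))" .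
      show "((cdf D \<circ> real_of_ereal) \<longlongrightarrow> 1) (at_left \<infinity>)"
        using D.cdf_lim_at_top_prob by (simp add: ereal_tendsto_simps)
      then show "((cdf D \<circ> real_of_ereal) \<longlongrightarrow> 1) (at_left \<infinity>)" .
      have "isCont f y" if "ereal x < ereal y" for y
        using that \<open>0 \<le> x\<close> f(2) by (simp add: continuous_on_eq_continuous_at)
      then show "isCont f y" "isCont f y" if "ereal x < ereal y" for y using that by blast+
    qed (use that f in auto)
    have "emeasure (density lborel (\<lambda>x. ennreal (f x))) {x<..} = (\<integral>\<^sup>+y. ennreal (indicator {x<..} y * f y) \<partial>lborel)"
      by (subst emeasure_density) (auto intro!: nn_integral_cong simp: indicator_def)
    also have "\<dots> = ennreal (LBINT y. indicator {x<..} y * f y)"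
      using * f(3) by (intro nn_integral_eq_integral) (auto simp: set_integrable_def einterval_def greaterThan_def)
    also have "(LBINT y. indicator {x<..} y * f y) = 1 - cdf D x"
      using *(2) by (simp add: interval_lebesgue_integral_le_eq set_lebesgue_integral_def einterval_def greaterThan_def)
    finally show ?thesis .
  qed
  have D_tail: "emeasure D {x<..} = ennreal (1 - cdf D x)" for x
    using D.prob_compl[of "{..x}"] by (simp add: cdf_def D.emeasure_eq_measure Compl_eq_Diff_UNIV[symmetric])
  show "D = density lborel (\<lambda>x. ennreal (f x))"
  proof (rule measure_eqI_lessThan)
    fix x
    show "emeasure D {x<..} < \<infinity>" by (simp add: D.emeasure_eq_measure)
    show "emeasure D {x<..} = emeasure (density lborel (\<lambda>x. ennreal (f x))) {x<..}"
    proof (cases "0 \<le> x")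
      case True then show ?thesis by (simp add: tail D_tail)
    next
      case False
      have "cdf D x = 0" using D.cdf_nondecreasing[of x 0] D.cdf_nonneg[of x] cdf0 False by auto
      moreover have "emeasure (density lborel (\<lambda>x. ennreal (f x))) {x<..} = emeasure (density lborel (\<lambda>x. ennreal (f x))) {0<..}"
        using f(4) False by (auto simp: emeasure_density indicator_def intro!: nn_integral_cong)
      ultimately show ?thesis using tail[of 0] by (simp add: D_tail cdf0)
    qed
  qed auto
qed

lemma (in positive_stable)
  shows cdf_has_derivative: "(cdf (distr M borel Y) has_real_derivative stable_density \<alpha> x) (at x)"
    and stable_density_nonneg: "0 \<le> stable_density \<alpha> x"
    and stable_density_nonpos: "x \<le> 0 \<Longrightarrow> stable_density \<alpha> x = 0"
    and stable_distributed: "distributed M lborel Y (\<lambda>x. ennreal (stable_density \<alpha> x))"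
proof -
  interpret D: prob_space "distr M borel Y" by (rule prob_space_distr) simp
  interpret D: real_distribution "distr M borel Y" by unfold_locales auto
  let ?F = "cdf (distr M borel Y)"
  have cont: "continuous_on S (stable_density \<alpha>)" for S
    using continuous_on_stable_density[OF \<alpha>] continuous_on_subset by blast
  show deriv: "(?F has_real_derivative stable_density \<alpha> x) (at x)" for x
  proof -
    have "((\<lambda>u. LBINT y=x-1..u. stable_density \<alpha> y) has_vector_derivative stable_density \<alpha> x) (at x within {x-1..x+1})"
      by (rule interval_integral_FTC2) (auto simp: cont)
    then have "((\<lambda>u. LBINT y=x-1..u. stable_density \<alpha> y) has_real_derivative stable_density \<alpha> x) (at x)"
      by (simp add: has_real_derivative_iff_has_vector_derivative at_within_Icc_at)
    then have "((\<lambda>u. ?F (x-1) + (LBINT y=x-1..u. stable_density \<alpha> y)) has_real_derivative stable_density \<alpha> x) (at x)"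
      by (auto intro!: derivative_eq_intros)
    then show ?thesis
    proof (rule has_field_derivative_transform_within_open)
      show "open {x-1<..}" "x \<in> {x-1<..}" by auto
      fix u assume "u \<in> {x-1<..}"
      then show "?F (x-1) + (LBINT y=x-1..u. stable_density \<alpha> y) = ?F u"
        using stable_density_interval_nonatom[of "x-1" u] D.cdf_diff_eq[of "x-1" u] by (simp add: measure_singleton)
    qed
  qed
  show nonneg': "0 \<le> stable_density \<alpha> x" for x
    by (rule mono_on_imp_deriv_nonneg[OF _ deriv, of UNIV]) (auto intro!: mono_onI D.cdf_nondecreasing)
  have neg: "?F x = 0" if "x \<le> 0" for x
  proof -
    have "?F 0 = measure (distr M borel Y) {0}"
      unfolding cdf_def using nonneg by (simp add: measure_distr) (intro arg_cong[where f = prob], force)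
    then have "?F 0 = 0" by (simp add: measure_singleton)
    then show ?thesis using D.cdf_nondecreasing[OF that] D.cdf_nonneg[of x] by simp
  qed
  \<comment> \<open>The distribution function is constant left of 0, so its derivative vanishes
    there; continuity then extends this to 0 itself.\<close>
  have zero: "stable_density \<alpha> x = 0" if "x \<in> {..<0}" for x
  proof -
    have "((\<lambda>_. 0) has_real_derivative stable_density \<alpha> x) (at x)"
    proof (rule has_field_derivative_transform_within_open[OF deriv])
      show "open {..<0::real}" "x \<in> {..<0}" using that by auto
    qed (auto intro: neg)
    then show ?thesis using DERIV_unique DERIV_const by blast
  qed
  show nonpos: "stable_density \<alpha> x = 0" if "x \<le> 0" for x
    by (rule continuous_constant_on_closure[OF cont zero, of "{..<0}"]) (use that in auto)
  have "distr M borel Y = density lborel (\<lambda>x. ennreal (stable_density \<alpha> x))" "stable_density \<alpha> \<in> borel_measurable borel"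
    using real_distribution_eq_density[OF D.real_distribution_axioms deriv cont nonneg' nonpos neg[of 0]] by simp_all
  then show "distributed M lborel Y (\<lambda>x. ennreal (stable_density \<alpha> x))"
    by (simp add: distributed_def cong: distr_cong)
qed

section \<open>The Wright series of the stable density\<close>

text \<open>Here u = exp w in the inversion integral: the leading \<open>exp w\<close> is the
  Jacobian and \<open>w - \<i> * of_real pi / 2\<close> is a logarithm of - i u, so the fractional
  power becomes an exponential without branch cut.\<close>

lemma stable_contour_primitive:
  fixes x \<alpha> :: real
  obtains P :: "complex \<Rightarrow> complex" where
    "\<And>w. (P has_field_derivative exp w * exp (- (\<i> * of_real x * exp w)) * exp (- exp (of_real \<alpha> * (w - \<i> * of_real pi / 2)))) (at w)"
proof -
  have "(\<lambda>w. exp w * exp (- (\<i> * of_real x * exp w)) * exp (- exp (of_real \<alpha> * (w - \<i> * of_real pi / 2)))) holomorphic_on UNIV"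
    by (intro holomorphic_intros)
  from holomorphic_convex_primitive'[OF convex_UNIV open_UNIV this] show ?thesis
    using that by auto
qed

text \<open>
  Dominates the primitive's derivative at \<^term>\<open>w = of_real (ln v) - \<i> * of_real \<theta>\<close> for all
  \<^term>\<open>\<theta>\<close> between 0 and \<^term>\<open>pi / 2\<close>: for small \<^term>\<open>\<theta>\<close> the fractional power still has positive real part
  (first summand), for the other angles the factor \<^term>\<open>exp (- (\<i> * of_real x * exp w))\<close> wins
  because \<^term>\<open>\<alpha> < 1\<close> (second summand).
\<close>
definition contour_bound :: "real \<Rightarrow> real \<Rightarrow> real \<Rightarrow> real" where
  "contour_bound \<alpha> x v = v * exp (- (cos (pi * (1 + \<alpha>) / 4) * v powr \<alpha>)) +
     v * exp (- (x * sin (min (pi / 4 * ((1 - \<alpha>) / \<alpha>)) (pi / 2)) * v) + v powr \<alpha>)"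

lemma contour_bound_tendsto_0:
  assumes "0 < x" "0 < \<alpha>" "\<alpha> < 1"
  shows "(contour_bound \<alpha> x \<longlongrightarrow> 0) at_top" "(contour_bound \<alpha> x \<longlongrightarrow> 0) (at_right 0)"
proof -
  define c k where "c = cos (pi * (1 + \<alpha>) / 4)" and "k = x * sin (min (pi / 4 * ((1 - \<alpha>) / \<alpha>)) (pi / 2))"
  \<comment> \<open>Both constants are positive: the cosine is taken at the midpoint of pi \<alpha>
    / 2 and pi/2, the sine at an angle in (0, pi/2].\<close>
  have "pi * (1 + \<alpha>) < pi * 2" using assms by (intro mult_strict_left_mono) auto
  then have c: "c > 0" unfolding c_def using assms by (intro cos_gt_zero) (auto simp: add_pos_pos)
  have k: "k > 0" unfolding k_def using assms by (intro mult_pos_pos sin_gt_zero) (auto simp: min_less_iff_disj)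
  have e: "contour_bound \<alpha> x = (\<lambda>v. v * exp (- (c * v powr \<alpha>)) + v * exp (- (k * v) + v powr \<alpha>))"
    by (simp add: contour_bound_def fun_eq_iff c_def k_def)
  have "((\<lambda>v. v * exp (- (c * v powr \<alpha>))) \<longlongrightarrow> 0) at_top" using c assms by real_asymp
  moreover have "((\<lambda>v. v * exp (- (k * v) + v powr \<alpha>)) \<longlongrightarrow> 0) at_top" using k assms by real_asymp
  ultimately show "(contour_bound \<alpha> x \<longlongrightarrow> 0) at_top" unfolding e by (auto intro: tendsto_add_zero)
  have "((\<lambda>v::real. v powr \<alpha>) \<longlongrightarrow> 0) (at_right 0)" using assms by real_asymp
  then have "((\<lambda>v. v * exp (- (c * v powr \<alpha>)) + v * exp (- (k * v) + v powr \<alpha>)) \<longlongrightarrow> 0 * exp (- (c * 0)) + 0 * exp (- (k * 0) + 0)) (at_right 0)"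
    by (intro tendsto_add tendsto_mult tendsto_exp tendsto_minus tendsto_const tendsto_ident_at)
  then show "(contour_bound \<alpha> x \<longlongrightarrow> 0) (at_right 0)" unfolding e by simp
qed

text \<open>With v = exp r and u = v exp (- i \<theta>), the modulus is v times exp (- x v sin
  \<theta>) times exp (- v^\<alpha> cos (\<alpha> (\<theta> + pi/2))).\<close>

lemma contour_bound:
  assumes x: "0 < x" and \<alpha>: "0 < \<alpha>" "\<alpha> < 1" and \<theta>: "0 \<le> \<theta>" "\<theta> \<le> pi / 2"
    and w: "w = of_real r - \<i> * of_real \<theta>"
  shows "norm (exp w * exp (- (\<i> * of_real x * exp w)) * exp (- exp (of_real \<alpha> * (w - \<i> * of_real pi / 2)))) \<le> contour_bound \<alpha> x (exp r)"
proof -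
  define v where "v = exp r"
  have v: "v > 0" by (simp add: v_def)
  have c: "cos (- (\<alpha> * \<theta>) - pi * \<alpha> / 2) = cos (\<alpha> * \<theta> + pi * \<alpha> / 2)"
    using cos_minus[of "\<alpha> * \<theta> + pi * \<alpha> / 2"] by simp
  have "norm (exp w * exp (- (\<i> * of_real x * exp w)) * exp (- exp (of_real \<alpha> * (w - \<i> * of_real pi / 2))))
     = v * exp (- (x * (v * sin \<theta>))) * exp (- (v powr \<alpha> * cos (\<alpha> * (\<theta> + pi / 2))))"
    by (simp add: w norm_mult Re_exp Im_exp v_def powr_def algebra_simps c)
  also have "\<dots> \<le> contour_bound \<alpha> x v"
  \<comment> \<open>At this threshold \<alpha> (\<theta> + pi/2) equals pi (1 + \<alpha>) / 4,
    halfway between its value at \<theta> = 0 and pi/2. Beyond it the cosine may be negative and is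
    only bounded below by -1.\<close>
  proof (cases "\<theta> \<le> pi / 4 * ((1 - \<alpha>) / \<alpha>)")
    case True
    then have "\<alpha> * (\<theta> + pi / 2) \<le> pi * (1 + \<alpha>) / 4" using \<alpha> by (simp add: field_simps)
    moreover have "pi * (1 + \<alpha>) / 4 \<le> pi" using \<alpha> by simp
    ultimately have "cos (pi * (1 + \<alpha>) / 4) \<le> cos (\<alpha> * (\<theta> + pi / 2))"
      using \<alpha> \<theta> by (intro cos_monotone_0_pi_le) auto
    then have "exp (- (v powr \<alpha> * cos (\<alpha> * (\<theta> + pi / 2)))) \<le> exp (- (cos (pi * (1 + \<alpha>) / 4) * v powr \<alpha>))"
      by (simp add: mult.commute mult_left_mono)
    moreover have "exp (- (x * (v * sin \<theta>))) \<le> 1" using x v \<theta> sin_ge_zero[of \<theta>] by simp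
    ultimately have "v * exp (- (x * (v * sin \<theta>))) * exp (- (v powr \<alpha> * cos (\<alpha> * (\<theta> + pi / 2)))) \<le> v * 1 * exp (- (cos (pi * (1 + \<alpha>) / 4) * v powr \<alpha>))"
      using v by (intro mult_mono) auto
    also have "\<dots> \<le> contour_bound \<alpha> x v" using v by (simp add: contour_bound_def)
    finally show ?thesis .
  next
    case False
    have "sin (min (pi / 4 * ((1 - \<alpha>) / \<alpha>)) (pi / 2)) \<le> sin \<theta>"
      using False \<theta> \<alpha> by (intro sin_monotone_2pi_le) (auto simp: min_def intro: order_trans[of _ 0])
    then have "x * sin (min (pi / 4 * ((1 - \<alpha>) / \<alpha>)) (pi / 2)) * v \<le> x * (v * sin \<theta>)"
      using x v by simp
    moreover have "v powr \<alpha> * (- cos (\<alpha> * (\<theta> + pi / 2))) \<le> v powr \<alpha> * 1"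
      by (intro mult_left_mono) (auto simp: minus_le_iff[of _ 1])
    ultimately have "exp (- (x * (v * sin \<theta>)) + - (v powr \<alpha> * cos (\<alpha> * (\<theta> + pi / 2)))) \<le> exp (- (x * sin (min (pi / 4 * ((1 - \<alpha>) / \<alpha>)) (pi / 2)) * v) + v powr \<alpha>)"
      by simp
    then have "exp (- (x * (v * sin \<theta>))) * exp (- (v powr \<alpha> * cos (\<alpha> * (\<theta> + pi / 2)))) \<le> exp (- (x * sin (min (pi / 4 * ((1 - \<alpha>) / \<alpha>)) (pi / 2)) * v) + v powr \<alpha>)"
      by (simp only: exp_add)
    then have "v * exp (- (x * (v * sin \<theta>))) * exp (- (v powr \<alpha> * cos (\<alpha> * (\<theta> + pi / 2)))) \<le> v * exp (- (x * sin (min (pi / 4 * ((1 - \<alpha>) / \<alpha>)) (pi / 2)) * v) + v powr \<alpha>)"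
      using v by (simp only: mult.assoc mult_le_cancel_left_pos)
    also have "\<dots> \<le> contour_bound \<alpha> x v" using v by (simp add: contour_bound_def)
    finally show ?thesis .
  qed
  finally show ?thesis by (simp add: v_def)
qed

text \<open>The inversion integrand at u = - i v, without the Jacobian - i. The turn carries the
  argument of - i u from -pi/2 to -pi, whereas the principal \<open>powr\<close> on the negative
  axis would use +pi; hence \<open>cis\<close>.\<close>

definition rotated_kernel :: "real \<Rightarrow> real \<Rightarrow> real \<Rightarrow> complex" where
  "rotated_kernel \<alpha> x v = exp (- (of_real x * of_real v)) * exp (- (of_real (v powr \<alpha>) * cis (- (pi * \<alpha>))))"

text \<open>The compact intervals stay away from 0, so that \<open>ln v\<close> is finite and
  primitives can be evaluated at both ends.\<close>

lemma LBINT_exhaust_positive: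
  fixes f :: "real \<Rightarrow> 'b::{banach, second_countable_topology}"
  assumes "set_integrable lborel {0<..} f"
  shows "(\<lambda>n. LBINT v:{1 / real (Suc n)..real (Suc n)}. f v) \<longlonglongrightarrow> (LBINT v:{0<..}. f v)"
  unfolding set_lebesgue_integral_def
proof (rule integral_dominated_convergence[where w = "\<lambda>v. norm (indicator {0<..} v *\<^sub>R f v)"])
  have pos: "0 < v" if "1 / real (Suc n) \<le> v" for n v
    using that by (rule less_le_trans[rotated]) simp
  have m: "(\<lambda>v. indicator {0<..} v *\<^sub>R f v) \<in> borel_measurable lborel" using assms by (auto simp: set_integrable_def)
  then show "(\<lambda>v. indicator {0<..} v *\<^sub>R f v) \<in> borel_measurable lborel" .
  show "(\<lambda>v. indicator {1 / real (Suc n)..real (Suc n)} v *\<^sub>R f v) \<in> borel_measurable lborel" for n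
  proof -
    have "(\<lambda>v. indicator {1 / real (Suc n)..real (Suc n)} v *\<^sub>R (indicator {0<..} v *\<^sub>R f v)) \<in> borel_measurable lborel"
      using m by measurable
    also have "(\<lambda>v. indicator {1 / real (Suc n)..real (Suc n)} v *\<^sub>R (indicator {0<..} v *\<^sub>R f v)) = (\<lambda>v. indicator {1 / real (Suc n)..real (Suc n)} v *\<^sub>R f v)"
      using pos[of n] by (auto simp: fun_eq_iff indicator_def)
    finally show ?thesis .
  qed
  show "integrable lborel (\<lambda>v. norm (indicator {0<..} v *\<^sub>R f v))"
    using assms unfolding set_integrable_def by (rule integrable_norm)
  show "AE v in lborel. (\<lambda>n. indicator {1 / real (Suc n)..real (Suc n)} v *\<^sub>R f v) \<longlonglongrightarrow> indicator {0<..} v *\<^sub>R f v"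
  proof (rule AE_I2, cases)
    fix v :: real assume "v > 0"
    then obtain N :: nat where N: "max v (1 / v) < real N" using reals_Archimedean2 by blast
    have "\<forall>\<^sub>F n in sequentially. indicator {1 / real (Suc n)..real (Suc n)} v *\<^sub>R f v = indicator {0<..} v *\<^sub>R f v"
      using eventually_ge_at_top[of N]
    proof eventually_elim
      case (elim n)
      then have "max v (1 / v) < real (Suc n)" using N by linarith
      then show ?case using \<open>v > 0\<close> by (auto simp: indicator_def field_simps)
    qed
    then show "(\<lambda>n. indicator {1 / real (Suc n)..real (Suc n)} v *\<^sub>R f v) \<longlonglongrightarrow> indicator {0<..} v *\<^sub>R f v"
      by (rule tendsto_eventually)
  next
    fix v :: real assume "\<not> v > 0"
    then have "\<not> (1 / real (Suc n) \<le> v)" for n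
      using pos by blast
    then show "(\<lambda>n. indicator {1 / real (Suc n)..real (Suc n)} v *\<^sub>R f v) \<longlonglongrightarrow> indicator {0<..} v *\<^sub>R f v"
      using \<open>\<not> v > 0\<close> by (simp add: indicator_def)
  qed
  show "AE v in lborel. norm (indicator {1 / real (Suc n)..real (Suc n)} v *\<^sub>R f v) \<le> norm (indicator {0<..} v *\<^sub>R f v)" for n
  proof (rule AE_I2)
    fix v :: real
    show "norm (indicator {1 / real (Suc n)..real (Suc n)} v *\<^sub>R f v) \<le> norm (indicator {0<..} v *\<^sub>R f v)"
      using pos[of n v] by (auto simp: indicator_def)
  qed
qed

text \<open>A majorant used twice: for the rotated kernel, whose fractional power makes it grow when
  \<alpha> > 1/2, and for the series of absolute values. It is integrable because v^\<alpha> is of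
  lower order than v.\<close>

lemma set_integrable_exp_growth:
  fixes x \<alpha> :: real
  assumes "0 < x" "0 < \<alpha>" "\<alpha> < 1"
  shows "set_integrable lborel {0<..} (\<lambda>v. exp (- (x * v) + v powr \<alpha>))"
proof -
  have "integrable lborel (\<lambda>v. exp (- (x * \<bar>v\<bar>) + \<bar>v\<bar> powr \<alpha>))"
  proof (rule integrable_continuous_decay)
    have "((\<lambda>v. (1 + v\<^sup>2) * exp (- (x * v) + v powr \<alpha>)) \<longlongrightarrow> 0) at_top"
      using assms by real_asymp
    then show "((\<lambda>v. (1 + v\<^sup>2) * exp (- (x * \<bar>v\<bar>) + \<bar>v\<bar> powr \<alpha>)) \<longlongrightarrow> 0) at_top"
      by (rule Lim_transform_eventually) (auto intro!: eventually_mono[OF eventually_ge_at_top[of 0]])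
    then show "((\<lambda>v. (1 + v\<^sup>2) * exp (- (x * \<bar>v\<bar>) + \<bar>v\<bar> powr \<alpha>)) \<longlongrightarrow> 0) at_bot"
      by (simp add: filterlim_at_bot_mirror)
  qed (intro continuous_on_exp continuous_on_minus continuous_on_add continuous_on_mult continuous_on_const continuous_on_powr' continuous_on_rabs continuous_on_id; use assms in auto)
  then have "set_integrable lborel {0<..} (\<lambda>v. exp (- (x * \<bar>v\<bar>) + \<bar>v\<bar> powr \<alpha>))"
    unfolding set_integrable_def by (intro integrable_mult_indicator) auto
  then show ?thesis by (rule set_integrable_cong[THEN iffD1, rotated -1]) auto
qed

lemma set_integrable_rotated_kernel:
  assumes "0 < x" "0 < \<alpha>" "\<alpha> < 1"
  shows "set_integrable lborel {0<..} (rotated_kernel \<alpha> x)"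
proof -
  have bd: "norm (rotated_kernel \<alpha> x v) \<le> exp (- (x * v) + v powr \<alpha>)" for v
  proof -
    have "v powr \<alpha> * (- cos (pi * \<alpha>)) \<le> v powr \<alpha> * 1"
      by (intro mult_left_mono) (auto simp: minus_le_iff[of _ 1])
    then show ?thesis by (simp add: rotated_kernel_def norm_mult flip: exp_add)
  qed
  have "rotated_kernel \<alpha> x \<in> borel_measurable borel"
    unfolding rotated_kernel_def by measurable
  then show ?thesis
    using bd by (intro set_integrable_bound[OF set_integrable_exp_growth[OF assms]])
      (auto simp: set_borel_measurable_def)
qed

text \<open>
  With \<^term>\<open>exp w\<close> for the integration variable the integrand becomes entire, and both rays become
  horizontal lines at distance \<^term>\<open>pi / 2\<close>; a global primitive replaces contour integration, and only
  the two short vertical segments have to be estimated.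
\<close>
lemma rotate_contour:
  assumes x: "0 < x" and \<alpha>: "0 < \<alpha>" "\<alpha> < 1"
  shows "(LBINT v:{0<..}. iexp (- (v * x)) * stable_char \<alpha> v) = - \<i> * (LBINT v:{0<..}. rotated_kernel \<alpha> x v)"
proof -
  define G where "G = (\<lambda>w. exp w * exp (- (\<i> * of_real x * exp w)) * exp (- exp (of_real \<alpha> * (w - \<i> * of_real pi / 2))))"
  obtain P where P: "\<And>w. (P has_field_derivative G w) (at w)"
    using stable_contour_primitive[of x \<alpha>] unfolding G_def by blast
  have "set_integrable lborel {0<..} (\<lambda>v. iexp (- (v * x)) * stable_char \<alpha> v)" (is "set_integrable _ _ ?K")
  proof -
    have [measurable]: "stable_char \<alpha> \<in> borel_measurable borel"
      using \<alpha> by (auto intro!: borel_measurable_continuous_onI continuous_on_stable_char)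
    have "integrable lborel (\<lambda>v. iexp (- (v * x)) * stable_char \<alpha> v)"
      by (rule Bochner_Integration.integrable_bound[OF integrable_stable_char[OF \<alpha>]]) (auto simp: norm_mult)
    then show ?thesis unfolding set_integrable_def by (intro integrable_mult_indicator) auto
  qed
  note lim1 = LBINT_exhaust_positive[OF this]
  note lim2 = LBINT_exhaust_positive[OF set_integrable_rotated_kernel[OF x \<alpha>]]
  define a b where "a = (\<lambda>n. 1 / real (Suc n))" and "b = (\<lambda>n. real (Suc n))"
  have ab: "0 < a n" "a n \<le> b n" for n by (auto simp: a_def b_def field_simps)
  \<comment> \<open>Increment of the primitive across the vertical segment that joins the two
    horizontal lines at modulus v.\<close>
  define Q where "Q = (\<lambda>v. P (of_real (ln v)) - P (of_real (ln v) - \<i> * of_real (pi / 2)))"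
  have e: "exp (of_real (ln v)) = complex_of_real v" if "v > 0" for v using that by (simp add: exp_of_real)
  have I1: "(LBINT v:{a n..b n}. iexp (- (v * x)) * stable_char \<alpha> v) = P (of_real (ln (b n))) - P (of_real (ln (a n)))" for n
  proof -
    have "(LBINT v=a n..b n. ?K v) = P (of_real (ln (b n))) - P (of_real (ln (a n)))"
    proof (rule interval_integral_FTC_finite)
      show "continuous_on {min (a n) (b n)..max (a n) (b n)} ?K"
        by (intro continuous_intros continuous_on_subset[OF continuous_on_stable_char] \<alpha>) auto
      fix v assume "min (a n) (b n) \<le> v"
      then have v: "v > 0" using ab[of n] by (simp add: min_def)
      have "((\<lambda>v. P (of_real (ln v))) has_vector_derivative of_real (1 / v) * G (of_real (ln v))) (at v)"
      proof (rule field_vector_diff_chain_at[of "\<lambda>v. of_real (ln v)", unfolded comp_def])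
        show "((\<lambda>v. complex_of_real (ln v)) has_vector_derivative of_real (1 / v)) (at v)"
          using v by (intro has_vector_derivative_of_real) (auto simp flip: has_real_derivative_iff_has_vector_derivative intro!: derivative_eq_intros)
      qed (rule P)
      \<comment> \<open>The derivative 1 / v of the logarithm cancels the Jacobian exp w =
        v.\<close>
      also have "of_real (1 / v) * G (of_real (ln v)) = ?K v"
      proof -
        have "exp (of_real \<alpha> * (of_real (ln v) - \<i> * of_real pi / 2)) = of_real (v powr \<alpha>) * cis (- (pi * \<alpha> / 2))"
          using v by (simp add: cis_conv_exp powr_def exp_add[symmetric] exp_of_real[symmetric] algebra_simps)
        then show ?thesis using v by (simp add: G_def e stable_char_def powr_imaginary_axis mult_ac)
      qed
      finally show "((\<lambda>v. P (of_real (ln v))) has_vector_derivative ?K v) (at v within {min (a n) (b n)..max (a n) (b n)})"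
        by (rule has_vector_derivative_at_within)
    qed
    then show ?thesis using ab[of n] by (simp add: interval_integral_Icc)
  qed
  have I2: "- \<i> * (LBINT v:{a n..b n}. rotated_kernel \<alpha> x v) = P (of_real (ln (b n)) - \<i> * of_real (pi / 2)) - P (of_real (ln (a n)) - \<i> * of_real (pi / 2))" for n
  proof -
    have "(LBINT v=a n..b n. - \<i> * rotated_kernel \<alpha> x v) = P (of_real (ln (b n)) - \<i> * of_real (pi / 2)) - P (of_real (ln (a n)) - \<i> * of_real (pi / 2))"
    proof (rule interval_integral_FTC_finite)
      show "continuous_on {min (a n) (b n)..max (a n) (b n)} (\<lambda>v. - \<i> * rotated_kernel \<alpha> x v)"
        unfolding rotated_kernel_def using ab[of n]
        by (intro continuous_intros) auto
      fix v assume "min (a n) (b n) \<le> v"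
      then have v: "v > 0" using ab[of n] by (simp add: min_def)
      have "((\<lambda>v. P (of_real (ln v) - \<i> * of_real (pi / 2))) has_vector_derivative of_real (1 / v) * G (of_real (ln v) - \<i> * of_real (pi / 2))) (at v)"
      proof (rule field_vector_diff_chain_at[of "\<lambda>v. of_real (ln v) - \<i> * of_real (pi / 2)", unfolded comp_def])
        have "((\<lambda>v. complex_of_real (ln v)) has_vector_derivative of_real (1 / v)) (at v)"
          using v by (intro has_vector_derivative_of_real) (auto simp flip: has_real_derivative_iff_has_vector_derivative intro!: derivative_eq_intros)
        from has_vector_derivative_diff[OF this has_vector_derivative_const]
        show "((\<lambda>v. complex_of_real (ln v) - \<i> * of_real (pi / 2)) has_vector_derivative of_real (1 / v)) (at v)" by simp
      qed (rule P)
      also have "of_real (1 / v) * G (of_real (ln v) - \<i> * of_real (pi / 2)) = - \<i> * rotated_kernel \<alpha> x v"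
      proof -
        have 1: "exp (of_real (ln v) - \<i> * of_real (pi / 2)) = - \<i> * of_real v"
        proof -
          have "exp (\<i> * complex_of_real (pi / 2)) = \<i>" by (simp only: cis_conv_exp[symmetric] cis_pi_half)
          then show ?thesis by (simp only: exp_diff e[OF v]) (simp add: divide_i)
        qed
        have 2: "exp (of_real \<alpha> * (of_real (ln v) - \<i> * of_real (pi / 2) - \<i> * of_real pi / 2)) = of_real (v powr \<alpha>) * cis (- (pi * \<alpha>))"
          using v by (simp add: cis_conv_exp powr_def exp_add[symmetric] exp_of_real[symmetric] algebra_simps)
        have 3: "\<i> * complex_of_real x * (\<i> * of_real v) = - (of_real x * of_real v)"
          by (simp add: complex_eq_iff)
        show ?thesis unfolding G_def 1 2 rotated_kernel_def using v by (simp add: 3)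
      qed
      finally show "((\<lambda>v. P (of_real (ln v) - \<i> * of_real (pi / 2))) has_vector_derivative - \<i> * rotated_kernel \<alpha> x v) (at v within {min (a n) (b n)..max (a n) (b n)})"
        by (rule has_vector_derivative_at_within)
    qed
    then show ?thesis using ab(2)[of n] by (simp only: interval_integral_Icc set_integral_mult_right)
  qed
  have Q: "norm (Q v) \<le> contour_bound \<alpha> x v * (pi / 2)" if "v > 0" for v
  proof -
    define u :: complex where "u = of_real (ln v)"
    define S where "S = closed_segment u (u - \<i> * of_real (pi / 2))"
    have "norm (P u - P (u - \<i> * of_real (pi / 2))) \<le> contour_bound \<alpha> x v * norm (u - (u - \<i> * of_real (pi / 2)))"
    proof (rule field_differentiable_bound[of S])
      show "(P has_field_derivative G z) (at z within S)" for z using P by (rule has_field_derivative_at_within)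
      fix z assume "z \<in> S"
      then obtain s where s: "0 \<le> s" "s \<le> 1" "z = (1 - s) *\<^sub>R u + s *\<^sub>R (u - \<i> * of_real (pi / 2))"
        by (auto simp: S_def closed_segment_def)
      show "norm (G z) \<le> contour_bound \<alpha> x v"
      proof -
        have "z = of_real (ln v) - \<i> * of_real (s * (pi / 2))"
          by (simp add: s(3) u_def scaleR_conv_of_real algebra_simps)
        then show ?thesis
          using contour_bound[OF x \<alpha>, of "s * (pi / 2)" z "ln v"] s(1,2) that
          by (simp add: G_def mult_left_le_one_le)
      qed
    qed (auto simp: S_def)
    then show ?thesis by (simp add: Q_def u_def norm_mult)
  qed
  have Q0: "(\<lambda>n. Q (X n)) \<longlonglongrightarrow> 0" if X: "(\<lambda>n. contour_bound \<alpha> x (X n)) \<longlonglongrightarrow> 0" "\<And>n. X n > 0" for X :: "nat \<Rightarrow> real"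
  proof (rule Lim_null_comparison)
    show "\<forall>\<^sub>F n in sequentially. norm (Q (X n)) \<le> contour_bound \<alpha> x (X n) * (pi / 2)" using Q X(2) by simp
    show "(\<lambda>n. contour_bound \<alpha> x (X n) * (pi / 2)) \<longlonglongrightarrow> 0" by (rule tendsto_mult_left_zero[OF X(1)])
  qed
  have "filterlim b at_top sequentially" unfolding b_def
    by (rule filterlim_compose[OF filterlim_real_sequentially filterlim_Suc])
  moreover have "filterlim a (at_right 0) sequentially"
    unfolding a_def using LIMSEQ_Suc[OF lim_1_over_n] by (auto simp: filterlim_at)
  ultimately have "(\<lambda>n. Q (b n)) \<longlonglongrightarrow> 0" "(\<lambda>n. Q (a n)) \<longlonglongrightarrow> 0"
    using contour_bound_tendsto_0[OF x \<alpha>, THEN filterlim_compose] ab less_le_trans[OF ab] by (intro Q0; blast)+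
  then have "(\<lambda>n. Q (b n) - Q (a n)) \<longlonglongrightarrow> 0 - 0" by (rule tendsto_diff)
  \<comment> \<open>The four endpoint values of \<open>P\<close> regroup: the difference of the
    increments along the lines is the difference of the increments across them.\<close>
  moreover have "Q (b n) - Q (a n) = (LBINT v:{a n..b n}. ?K v) - (- \<i> * (LBINT v:{a n..b n}. rotated_kernel \<alpha> x v))" for n
    unfolding I1 I2 by (simp add: Q_def)
  moreover have "(\<lambda>n. (LBINT v:{a n..b n}. ?K v) - (- \<i> * (LBINT v:{a n..b n}. rotated_kernel \<alpha> x v)))
      \<longlonglongrightarrow> (LBINT v:{0<..}. ?K v) - (- \<i> * (LBINT v:{0<..}. rotated_kernel \<alpha> x v))"
    unfolding a_def b_def by (intro tendsto_intros lim1 lim2)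
  ultimately have "(LBINT v:{0<..}. ?K v) - (- \<i> * (LBINT v:{0<..}. rotated_kernel \<alpha> x v)) = 0"
    by (simp add: LIMSEQ_unique)
  then show ?thesis by (rule eq_iff_diff_eq_0[THEN iffD2])
qed

text \<open>The integrand at -v is the conjugate of the one at v, so the integral over the line has
  twice the real part of the half-line integral. The factor - i of the rotation turns that real part
  into an imaginary part, and 2 / (2 pi) leaves 1 / pi.\<close>

lemma stable_density_eq_rotated:
  assumes x: "0 < x" and \<alpha>: "0 < \<alpha>" "\<alpha> < 1"
  shows "stable_density \<alpha> x = Im (LBINT v:{0<..}. rotated_kernel \<alpha> x v) / pi"
proof -
  define K where "K = (\<lambda>v. iexp (- (v * x)) * stable_char \<alpha> v)"
  have [measurable]: "stable_char \<alpha> \<in> borel_measurable borel"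
    using \<alpha> by (auto intro!: borel_measurable_continuous_onI continuous_on_stable_char)
  have K: "integrable lborel K" unfolding K_def
    by (rule Bochner_Integration.integrable_bound[OF integrable_stable_char[OF \<alpha>]]) (auto simp: norm_mult)
  have KA: "integrable lborel (\<lambda>v. indicator A v *\<^sub>R K v)" if "A \<in> sets lborel" for A
    using K that by (intro integrable_mult_indicator)
  have refl: "K (- v) = cnj (K v)" for v
  proof (cases v "0::real" rule: linorder_cases)
    case equal then show ?thesis by (simp add: K_def stable_char_def)
  qed (auto simp: K_def stable_char_def powr_imaginary_axis[unfolded of_real_minus] exp_cnj cis_cnj simp del: of_real_minus,
       insert powr_imaginary_axis[of "-v" \<alpha>], auto simp: exp_cnj cis_cnj)
  have "(CLINT v|lborel. K v) = (CLINT v|lborel. indicator {0<..} v *\<^sub>R K v + indicator {..<0} v *\<^sub>R K v)"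
  proof (rule integral_cong_AE)
    have "AE t in lborel. t \<noteq> (0::real)" by (rule AE_lborel_singleton)
    then show "AE v in lborel. K v = indicator {0<..} v *\<^sub>R K v + indicator {..<0} v *\<^sub>R K v"
      by eventually_elim (auto simp: indicator_def)
  qed (auto simp: K_def)
  also have "\<dots> = (CLINT v|lborel. indicator {0<..} v *\<^sub>R K v) + (CLINT v|lborel. indicator {..<0} v *\<^sub>R K v)"
    by (intro Bochner_Integration.integral_add KA) auto
  also have "(CLINT v|lborel. indicator {..<0} v *\<^sub>R K v) = (CLINT v|lborel. indicator {..<0} (0 + (-1) * v) *\<^sub>R K (0 + (-1) * v))"
    by (subst lborel_integral_real_affine[where c = "-1" and t = 0]) auto
  also have "\<dots> = (CLINT v|lborel. cnj (indicator {0<..} v *\<^sub>R K v))"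
    by (intro Bochner_Integration.integral_cong) (auto simp: refl indicator_def)
  also have "\<dots> = cnj (CLINT v|lborel. indicator {0<..} v *\<^sub>R K v)"
    by (rule Bochner_Integration.integral_cnj)
  finally have "Re (CLINT v|lborel. K v) = 2 * Re (CLINT v|lborel. indicator {0<..} v *\<^sub>R K v)" by simp
  also have "(CLINT v|lborel. indicator {0<..} v *\<^sub>R K v) = - \<i> * (LBINT v:{0<..}. rotated_kernel \<alpha> x v)"
    using rotate_contour[OF assms] by (simp add: K_def set_lebesgue_integral_def)
  finally show ?thesis by (simp add: stable_density_def K_def)
qed

section \<open>Termwise integration of the rotated kernel and the Wright series\<close>

lemma has_bochner_integral_powr_exp:
  fixes a x :: real
  assumes "0 < x" "-1 < a"
  shows "has_bochner_integral lborel (\<lambda>v. indicator {0<..} v * (v powr a * exp (- (x * v)))) (Gamma (a + 1) / x powr (a + 1))"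
proof (rule has_bochner_integral_nn_integral)
  have "ennreal (Gamma (a + 1)) = (\<integral>\<^sup>+t. ennreal (indicator {0..} t * t powr a / exp t) \<partial>lborel)"
    using Gamma_conv_nn_integral_real[of "a + 1"] assms by simp
  also have "\<dots> = (\<integral>\<^sup>+t. ennreal (indicator {0<..} t * t powr a / exp t) \<partial>lborel)"
    using AE_lborel_singleton[of 0] by (intro nn_integral_cong_AE) (auto elim!: eventually_mono simp: indicator_def)
  also have "\<dots> = \<bar>x\<bar> * (\<integral>\<^sup>+v. ennreal (indicator {0<..} (0 + x * v) * (0 + x * v) powr a / exp (0 + x * v)) \<partial>lborel)"
    using assms by (intro nn_integral_real_affine) auto
  also have "\<dots> = (\<integral>\<^sup>+v. ennreal (x powr (a + 1)) * ennreal (indicator {0<..} v * (v powr a * exp (- (x * v)))) \<partial>lborel)"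
    using assms by (subst nn_integral_cmult[symmetric])
      (auto intro!: nn_integral_cong simp: indicator_def powr_mult powr_add exp_minus field_simps zero_less_mult_iff simp flip: ennreal_mult)
  also have "\<dots> = ennreal (x powr (a + 1)) * (\<integral>\<^sup>+v. ennreal (indicator {0<..} v * (v powr a * exp (- (x * v)))) \<partial>lborel)"
    by (intro nn_integral_cmult) auto
  finally have *: "ennreal (Gamma (a + 1)) = ennreal (x powr (a + 1)) * (\<integral>\<^sup>+v. ennreal (indicator {0<..} v * (v powr a * exp (- (x * v)))) \<partial>lborel)" .
  have "ennreal (Gamma (a + 1) / x powr (a + 1)) = ennreal (Gamma (a + 1)) / ennreal (x powr (a + 1))"
    using assms Gamma_real_pos[of "a + 1"] by (intro divide_ennreal[symmetric]) auto
  also have "\<dots> = (\<integral>\<^sup>+v. ennreal (indicator {0<..} v * (v powr a * exp (- (x * v)))) \<partial>lborel)"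
    unfolding * using assms by (simp add: mult_divide_eq_ennreal mult.commute[of "ennreal (x powr _)"])
  finally show "(\<integral>\<^sup>+v. ennreal (indicator {0<..} v * (v powr a * exp (- (x * v)))) \<partial>lborel) = ennreal (Gamma (a + 1) / x powr (a + 1))" by simp
  show "0 \<le> Gamma (a + 1) / x powr (a + 1)" using assms Gamma_real_pos[of "a + 1"] by (simp add: less_imp_le)
qed auto

text \<open>The exponential of the fractional power is expanded; the moduli of the terms add up to
  exp (- x v + v^\<alpha>), whose integrability justifies exchanging sum and integral. Each term is
  a Gamma integral.\<close>

lemma rotated_kernel_sums:
  fixes x \<alpha> :: real
  assumes x: "0 < x" and \<alpha>: "0 < \<alpha>" "\<alpha> < 1"
  shows "(\<lambda>k. (Gamma (\<alpha> * k + 1) / x powr (\<alpha> * k + 1) / fact k) *\<^sub>R ((-1) ^ k * cis (- (pi * \<alpha> * k)))) sums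
    (LBINT v:{0<..}. rotated_kernel \<alpha> x v)"
proof -
  define T where "T = (\<lambda>k v. (indicator {0<..} v * (v powr (\<alpha> * k) * exp (- (x * v)))) *\<^sub>R ((-1) ^ k * cis (- (pi * \<alpha> * k)) / fact k))"
  have hb: "has_bochner_integral lborel (\<lambda>v. indicator {0<..} v * (v powr (\<alpha> * k) * exp (- (x * v)))) (Gamma (\<alpha> * k + 1) / x powr (\<alpha> * k + 1))" for k :: nat
    using x \<alpha> by (intro has_bochner_integral_powr_exp) (auto intro: less_le_trans[of _ 0])
  have T: "has_bochner_integral lborel (T k) ((Gamma (\<alpha> * k + 1) / x powr (\<alpha> * k + 1) / fact k) *\<^sub>R ((-1) ^ k * cis (- (pi * \<alpha> * k))))" for k
    using has_bochner_integral_scaleR_left[OF hb, of k "(-1) ^ k * cis (- (pi * \<alpha> * k)) / fact k"]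
    by (simp add: T_def scaleR_conv_of_real field_simps)
  have normT: "norm (T k v) = indicator {0<..} v * (exp (- (x * v)) * ((v powr \<alpha>) ^ k /\<^sub>R fact k))" for k v
    by (cases "v > 0") (auto simp: T_def norm_mult norm_divide norm_power powr_powr[symmetric] powr_realpow divide_inverse norm_inverse mult_ac)
  have sums_norm: "(\<lambda>k. norm (T k v)) sums (indicator {0<..} v * (exp (- (x * v)) * exp (v powr \<alpha>)))" for v
    unfolding normT by (intro sums_mult exp_converges)
  have E: "integrable lborel (\<lambda>v. indicator {0<..} v * (exp (- (x * v)) * exp (v powr \<alpha>)))"
    using set_integrable_exp_growth[OF x \<alpha>] by (simp only: set_integrable_def exp_add real_scaleR_def)
  have "(\<lambda>k. integral\<^sup>L lborel (T k)) sums (LINT v|lborel. (\<Sum>k. T k v))"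
  proof (rule sums_integral)
    show int: "integrable lborel (T k)" for k using T by (rule integrable.intros)
    show "AE v in lborel. summable (\<lambda>k. norm (T k v))" using sums_norm by (auto simp: sums_iff)
    show "summable (\<lambda>k. LINT v|lborel. norm (T k v))"
    proof (rule bounded_imp_summable)
      show "0 \<le> (LINT v|lborel. norm (T k v))" for k by simp
      fix n
      have "(\<Sum>k\<le>n. LINT v|lborel. norm (T k v)) = (LINT v|lborel. (\<Sum>k\<le>n. norm (T k v)))"
        by (rule Bochner_Integration.integral_sum[symmetric]) (auto intro: integrable_norm int)
      also have "\<dots> \<le> (LINT v|lborel. indicator {0<..} v * (exp (- (x * v)) * exp (v powr \<alpha>)))"
      proof (intro integral_mono E)
        fix v :: real
        have "(\<Sum>k\<le>n. norm (T k v)) \<le> (\<Sum>k. norm (T k v))"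
          using sums_norm[of v] by (intro sum_le_suminf) (auto simp: sums_iff)
        then show "(\<Sum>k\<le>n. norm (T k v)) \<le> indicator {0<..} v * (exp (- (x * v)) * exp (v powr \<alpha>))"
          using sums_norm[of v] by (simp add: sums_iff)
      qed (intro Bochner_Integration.integrable_sum integrable_norm int)
      finally show "(\<Sum>k\<le>n. LINT v|lborel. norm (T k v)) \<le> (LINT v|lborel. indicator {0<..} v * (exp (- (x * v)) * exp (v powr \<alpha>)))" .
    qed
  qed
  moreover have "(\<Sum>k. T k v) = indicator {0<..} v *\<^sub>R rotated_kernel \<alpha> x v" for v
  proof (cases "v > 0")
    case True
    let ?z = "- (of_real (v powr \<alpha>) * cis (- (pi * \<alpha>)))"
    have "T k v = exp (- (of_real x * of_real v)) * (?z ^ k /\<^sub>R fact k)" for k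
    proof -
      have "?z ^ k = (-1) ^ k * (of_real (v powr (\<alpha> * k)) * cis (- (pi * \<alpha> * k)))"
        using True by (simp add: power_minus[of "_ * _"] power_mult_distrib Complex.DeMoivre powr_powr[symmetric] powr_realpow mult_ac)
      then show ?thesis using True
        by (simp add: T_def scaleR_conv_of_real field_simps flip: exp_of_real)
    qed
    moreover have "(\<lambda>k. exp (- (of_real x * of_real v)) * (?z ^ k /\<^sub>R fact k)) sums (exp (- (of_real x * of_real v)) * exp ?z)"
      by (intro sums_mult exp_converges)
    ultimately show ?thesis using True by (simp add: sums_iff rotated_kernel_def)
  qed (simp add: T_def)
  ultimately show ?thesis
    unfolding has_bochner_integral_integral_eq[OF T] by (simp add: set_lebesgue_integral_def)
qed

text \<open>Imaginary parts leave sin (pi \<alpha> k), and the reflection formula converts Gamma(z)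
  sin (pi z) / pi into 1 / Gamma(1 - z) at z = \<alpha> (n + 1).\<close>

theorem stable_density_eq_Wright:
  fixes x \<alpha> :: real
  assumes x: "0 < x" and \<alpha>: "0 < \<alpha>" "\<alpha> < 1"
  shows "stable_density \<alpha> x = \<alpha> * x powr (- \<alpha> - 1) * Wright (- \<alpha>) (1 - \<alpha>) (- (x powr (- \<alpha>)))"
proof -
  define f where "f = (\<lambda>k::nat. Gamma (\<alpha> * k + 1) / x powr (\<alpha> * k + 1) / fact k * ((-1) ^ Suc k * sin (pi * \<alpha> * k)))"
  define g where "g = (\<lambda>n::nat. (- (x powr (- \<alpha>))) ^ n / (fact n * Gamma (- \<alpha> * of_nat n + (1 - \<alpha>))))"
  have "(\<lambda>k. Im ((Gamma (\<alpha> * k + 1) / x powr (\<alpha> * k + 1) / fact k) *\<^sub>R ((-1) ^ k * cis (- (pi * \<alpha> * k))))) sums (Im (LBINT v:{0<..}. rotated_kernel \<alpha> x v))"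
    by (rule sums_Im[OF rotated_kernel_sums[OF assms]])
  moreover have "Im ((Gamma (\<alpha> * k + 1) / x powr (\<alpha> * k + 1) / fact k) *\<^sub>R ((-1) ^ k * cis (- (pi * \<alpha> * k)))) = f k" for k :: nat
  proof -
    have "((-1) ^ k :: complex) = of_real ((-1) ^ k)" by simp
    then show ?thesis by (simp only: f_def) simp
  qed
  ultimately have "f sums (Im (LBINT v:{0<..}. rotated_kernel \<alpha> x v))" by simp
  \<comment> \<open>The term k = 0 contains sin 0. Dropping it shifts the index by one, which is why
    the second Wright parameter is 1 - \<alpha>.\<close>
  then have "(\<lambda>n. f (Suc n)) sums (Im (LBINT v:{0<..}. rotated_kernel \<alpha> x v))"
    by (subst sums_Suc_iff) (simp add: f_def)
  then have "(\<lambda>n. f (Suc n) / pi) sums stable_density \<alpha> x"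
    unfolding stable_density_eq_rotated[OF assms] by (rule sums_divide)
  moreover have "f (Suc n) / pi = \<alpha> * x powr (- \<alpha> - 1) * g n" for n
  proof -
    define z where "z = \<alpha> * real (Suc n)"
    have z: "z > 0" using \<alpha> by (simp add: z_def)
    \<comment> \<open>The reciprocal Gamma function is entire, so a pole of Gamma at
      \<open>1 - z\<close> is no exception; there its value 0 agrees with the summand of
      \<open>Wright\<close>.\<close>
    have "complex_of_real (rGamma z * rGamma (1 - z)) = of_real (sin (pi * z) / pi)"
      using rGamma_reflection_complex[of "of_real z"]
      by (simp flip: rGamma_complex_of_real sin_of_real)
    then have r: "rGamma z * rGamma (1 - z) = sin (pi * z) / pi" by (simp only: of_real_eq_iff)
    have G: "Gamma z > 0" using z by (rule Gamma_real_pos)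
    have 1: "Gamma z * sin (pi * z) / pi = rGamma (1 - z)"
    proof -
      have "Gamma z * sin (pi * z) / pi = Gamma z * (rGamma z * rGamma (1 - z))" by (simp add: r)
      also have "\<dots> = rGamma (1 - z)" using G by (simp add: rGamma_inverse_Gamma[of z])
      finally show ?thesis .
    qed
    have 2: "Gamma (z + 1) = z * Gamma z"
      using z by (intro Gamma_plus1) (auto elim!: nonpos_Ints_cases)
    have 3: "- \<alpha> * of_nat n + (1 - \<alpha>) = 1 - z" by (simp add: z_def algebra_simps)
    have 4: "1 / x powr (z + 1) = x powr (- \<alpha> - 1) * x powr (- \<alpha> * n)"
    proof -
      have "- \<alpha> - 1 + - \<alpha> * n = - (z + 1)" by (simp add: z_def algebra_simps)
      then show ?thesis by (simp only: powr_add[symmetric] powr_minus_divide)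
    qed
    have 5: "(- (x powr (- \<alpha>))) ^ n = (-1) ^ n * x powr (- \<alpha> * n)"
      using x by (simp add: power_minus[of "_ powr _"] powr_powr flip: powr_realpow)
    have 6: "z / fact (Suc n) = \<alpha> / fact n" by (simp add: z_def field_simps del: of_nat_Suc)
    have "f (Suc n) / pi = Gamma (z + 1) / x powr (z + 1) / fact (Suc n) * ((-1) ^ n * sin (pi * z)) / pi"
      by (simp add: f_def z_def mult.assoc del: of_nat_Suc fact_Suc)
    also have "\<dots> = (z / fact (Suc n)) * (Gamma z * sin (pi * z) / pi) * (1 / x powr (z + 1)) * (-1) ^ n"
      unfolding 2 by (simp add: mult_ac del: of_nat_Suc fact_Suc)
    also have "\<dots> = \<alpha> * x powr (- \<alpha> - 1) * g n"
      unfolding 1 4 6 g_def 3 5 by (simp add: rGamma_inverse_Gamma divide_inverse)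
    finally show ?thesis .
  qed
  ultimately have s: "(\<lambda>n. \<alpha> * x powr (- \<alpha> - 1) * g n) sums stable_density \<alpha> x" by simp
  \<comment> \<open>Dividing by the nonzero prefactor also yields convergence of the Wright series,
    without which its \<open>suminf\<close> would carry no information.\<close>
  have "\<alpha> * x powr (- \<alpha> - 1) \<noteq> 0" using x \<alpha> by simp
  then have "g sums (stable_density \<alpha> x / (\<alpha> * x powr (- \<alpha> - 1)))"
    using sums_divide[OF s, of "\<alpha> * x powr (- \<alpha> - 1)"] by simp
  then have "Wright (- \<alpha>) (1 - \<alpha>) (- (x powr (- \<alpha>))) = stable_density \<alpha> x / (\<alpha> * x powr (- \<alpha> - 1))"
    by (simp add: Wright_def g_def sums_iff)
  then show ?thesis using x \<alpha> by simp
qed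

section \<open>Densities of the subordinator and of its inverse\<close>

text \<open>Self-similarity: a stable variable at time t is distributed as t^(1/\<alpha>) times one
  at time 1.\<close>

definition sub_density :: "real \<Rightarrow> real \<Rightarrow> real \<Rightarrow> real" where
  "sub_density \<alpha> x t = t powr (- 1 / \<alpha>) * stable_density \<alpha> (x * t powr (- 1 / \<alpha>))"

text \<open>For x > 0 this is the derivative in x of Pr{H(x) > t} = 1 - F(t x^(-1/\<alpha>)), F
  being the unit-time distribution function; space and time exchange roles in
  \<open>sub_density\<close>. The value 0 elsewhere is the one \<open>is_pdf\<close>
  prescribes.\<close>

definition inv_density :: "real \<Rightarrow> real \<Rightarrow> real \<Rightarrow> real" where
  "inv_density \<alpha> x t = (if 0 < x then t / (\<alpha> * x) * sub_density \<alpha> t x else 0)"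

lemma powr_neg_inverse_powr:
  fixes x \<alpha> :: real
  assumes "0 < x" "0 < \<alpha>"
  shows "(x powr (- 1 / \<alpha>)) powr \<alpha> = 1 / x"
proof -
  have "(x powr (- 1 / \<alpha>)) powr \<alpha> = x powr (- 1)"
    unfolding powr_powr using assms(2) by simp
  then show ?thesis using assms(1) by (simp add: powr_minus_divide)
qed

text \<open>At the point t x^(-1/\<alpha>) the argument of the Wright series becomes - x /
  t^\<alpha>, linear in x, and the prefactors cancel down to t^(-\<alpha>).\<close>

lemma inv_density_eq_Wright:
  assumes "0 < x" "0 < t" "0 < \<alpha>" "\<alpha> < 1"
  shows "inv_density \<alpha> x t = 1 / t powr \<alpha> * Wright (- \<alpha>) (1 - \<alpha>) (- (x / t powr \<alpha>))"
proof -
  define c where "c = x powr (- 1 / \<alpha>)"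
  have c: "c > 0" using assms by (simp add: c_def)
  have ca: "c powr \<alpha> = 1 / x" using assms by (simp only: c_def powr_neg_inverse_powr)
  have 1: "(t * c) powr (- \<alpha>) = x / t powr \<alpha>"
    using assms c by (simp add: powr_mult powr_minus ca divide_inverse)
  have 2: "(t * c) powr (- \<alpha> - 1) = x / t powr \<alpha> / (t * c)"
    using assms c by (simp add: powr_diff 1)
  have "inv_density \<alpha> x t = t / (\<alpha> * x) * (c * stable_density \<alpha> (t * c))"
    unfolding inv_density_def sub_density_def c_def[symmetric] using assms by simp
  also have "stable_density \<alpha> (t * c) = \<alpha> * (x / t powr \<alpha> / (t * c)) * Wright (- \<alpha>) (1 - \<alpha>) (- (x / t powr \<alpha>))"
    using assms c stable_density_eq_Wright[of "t * c" \<alpha>] by (simp only: 1 2 mult_pos_pos)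
  also have "t / (\<alpha> * x) * (c * \<dots>) = 1 / t powr \<alpha> * Wright (- \<alpha>) (1 - \<alpha>) (- (x / t powr \<alpha>))"
    using assms c by simp
  finally show ?thesis .
qed

lemma sub_density_measurable [measurable]:
  assumes "0 < \<alpha>" "\<alpha> < 1"
  shows "(\<lambda>x. sub_density \<alpha> x t) \<in> borel_measurable borel"
proof -
  have [measurable]: "stable_density \<alpha> \<in> borel_measurable borel"
    using assms by (auto intro!: borel_measurable_continuous_onI continuous_on_stable_density)
  show ?thesis unfolding sub_density_def by measurable
qed

section \<open>Laws at an arbitrary time and their Laplace transforms\<close>

locale stable_law = prob_space M for M :: "'a measure" +
  fixes \<alpha> t :: real and X :: "'a \<Rightarrow> real"
  assumes \<alpha>: "0 < \<alpha>" "\<alpha> < 1" and t: "0 < t"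
    and rv[measurable]: "random_variable borel X"
    and nonneg: "\<And>\<omega>. \<omega> \<in> space M \<Longrightarrow> 0 \<le> X \<omega>"
    and laplace: "\<And>\<mu>. \<mu> > 0 \<Longrightarrow> expectation (\<lambda>\<omega>. exp (- \<mu> * X \<omega>)) = exp (- t * \<mu> powr \<alpha>)"

sublocale stable_law \<subseteq> std: positive_stable M \<alpha> "\<lambda>\<omega>. t powr (- 1 / \<alpha>) * X \<omega>"
proof unfold_locales
  fix \<mu> :: real assume "\<mu> > 0"
  then have "expectation (\<lambda>\<omega>. exp (- (\<mu> * t powr (- 1 / \<alpha>)) * X \<omega>)) = exp (- t * (\<mu> * t powr (- 1 / \<alpha>)) powr \<alpha>)"
    using t by (intro laplace) auto
  also have "(\<mu> * t powr (- 1 / \<alpha>)) powr \<alpha> = \<mu> powr \<alpha> / t"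
    using \<open>\<mu> > 0\<close> t \<alpha> by (simp only: powr_mult powr_neg_inverse_powr) simp
  finally show "expectation (\<lambda>\<omega>. exp (- \<mu> * (t powr (- 1 / \<alpha>) * X \<omega>))) = exp (- (\<mu> powr \<alpha>))"
    using t by (simp add: mult.assoc)
qed (use \<alpha> t nonneg in auto)

context stable_law begin

lemma sub_density_nonneg: "0 \<le> sub_density \<alpha> x s"
  unfolding sub_density_def by (simp add: std.stable_density_nonneg)

lemma sub_density_nonpos: "x \<le> 0 \<Longrightarrow> sub_density \<alpha> x s = 0"
  unfolding sub_density_def by (subst std.stable_density_nonpos) (auto simp: mult_nonpos_nonneg)

lemma inv_density_nonneg: "0 \<le> inv_density \<alpha> x s"
  using \<alpha> sub_density_nonneg[of s x] sub_density_nonpos[of s x]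
  by (cases "0 \<le> s") (auto simp: inv_density_def)

lemma inv_density_nonpos: "s \<le> 0 \<Longrightarrow> inv_density \<alpha> x s = 0"
  by (simp add: inv_density_def sub_density_nonpos)

lemma distributed_sub_density: "distributed M lborel X (\<lambda>x. ennreal (sub_density \<alpha> x t))"
proof -
  define c where "c = t powr (1 / \<alpha>)"
  have c: "c > 0" "t powr (- 1 / \<alpha>) = 1 / c" using t by (auto simp: c_def powr_minus divide_inverse)
  have "distributed M lborel (\<lambda>\<omega>. 0 + c * (t powr (- 1 / \<alpha>) * X \<omega>)) (\<lambda>x. ennreal (stable_density \<alpha> ((x - 0) / c)) / \<bar>c\<bar>)"
    by (rule distributed_affine[OF std.stable_distributed]) (use c in auto)
  also have "(\<lambda>\<omega>. 0 + c * (t powr (- 1 / \<alpha>) * X \<omega>)) = X" using c by auto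
  also have "(\<lambda>x. ennreal (stable_density \<alpha> ((x - 0) / c)) / \<bar>c\<bar>) = (\<lambda>x. ennreal (sub_density \<alpha> x t))"
    using c std.stable_density_nonneg by (auto simp: fun_eq_iff sub_density_def divide_ennreal)
  finally show ?thesis .
qed

lemma nn_laplace_sub_density:
  assumes "0 < \<mu>"
  shows "(\<integral>\<^sup>+x. ennreal (exp (- \<mu> * x) * sub_density \<alpha> x t) \<partial>lborel) = ennreal (exp (- t * \<mu> powr \<alpha>))"
proof -
  have "(\<integral>\<^sup>+x. ennreal (exp (- \<mu> * x) * sub_density \<alpha> x t) \<partial>lborel) = (\<integral>\<^sup>+x. ennreal (sub_density \<alpha> x t) * ennreal (exp (- \<mu> * x)) \<partial>lborel)"
    by (simp add: mult.commute ennreal_mult' sub_density_nonneg)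
  also have "\<dots> = (\<integral>\<^sup>+\<omega>. ennreal (exp (- \<mu> * X \<omega>)) \<partial>M)"
    by (intro distributed_nn_integral[OF distributed_sub_density]) auto
  also have "\<dots> = ennreal (expectation (\<lambda>\<omega>. exp (- \<mu> * X \<omega>)))"
    by (intro nn_integral_eq_integral integrable_const_bound[where B = 1]) (use assms nonneg in auto)
  finally show ?thesis by (simp only: laplace[OF assms])
qed

text \<open>Differentiates the Laplace transform in \<^term>\<open>\<mu>\<close>.\<close>
lemma expectation_mult_exp:
  assumes \<mu>: "0 < \<mu>"
  shows "expectation (\<lambda>\<omega>. X \<omega> * exp (- \<mu> * X \<omega>)) = t * \<alpha> * \<mu> powr (\<alpha> - 1) * exp (- t * \<mu> powr \<alpha>)"
proof -
  let ?f = "\<lambda>z. expectation (\<lambda>\<omega>. exp (- (z * complex_of_real (X \<omega>))))"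
  let ?E = "expectation (\<lambda>\<omega>. X \<omega> * exp (- \<mu> * X \<omega>))"
  \<comment> \<open>The complex derivative is restricted to the real axis and compared with that of
    the explicit transform.\<close>
  have "(?f has_field_derivative - expectation (\<lambda>\<omega>. of_real (X \<omega>) * exp (- (of_real \<mu> * of_real (X \<omega>))))) (at (of_real \<mu>))"
    using \<mu> by (intro laplace_transform_has_field_derivative rv nonneg) auto
  also have "(\<lambda>\<omega>. complex_of_real (X \<omega>) * exp (- (of_real \<mu> * of_real (X \<omega>)))) = (\<lambda>\<omega>. of_real (X \<omega> * exp (- \<mu> * X \<omega>)))"
    by (simp add: fun_eq_iff flip: exp_of_real)
  also have "- expectation (\<lambda>\<omega>. complex_of_real (X \<omega> * exp (- \<mu> * X \<omega>))) = of_real (- ?E)"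
    by (simp only: integral_complex_of_real of_real_minus)
  finally have "((\<lambda>r. ?f (of_real r)) has_vector_derivative of_real (- ?E)) (at \<mu>)"
    by (rule has_vector_derivative_real_field)
  then have "((\<lambda>r. Re (?f (of_real r))) has_real_derivative - ?E) (at \<mu>)"
    by (simp add: has_vector_derivative_complex_iff)
  then have "((\<lambda>r. exp (- t * r powr \<alpha>)) has_real_derivative - ?E) (at \<mu>)"
  proof (rule has_field_derivative_transform_within_open)
    show "open {0::real<..}" "\<mu> \<in> {0<..}" using \<mu> by auto
    fix r :: real assume "r \<in> {0<..}"
    have "?f (of_real r) = expectation (\<lambda>\<omega>. complex_of_real (exp (- r * X \<omega>)))"
      by (simp flip: exp_of_real)
    also have "\<dots> = of_real (exp (- t * r powr \<alpha>))"
      using laplace[of r] \<open>r \<in> _\<close> by (simp only: integral_complex_of_real greaterThan_iff)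
    finally show "Re (?f (of_real r)) = exp (- t * r powr \<alpha>)" by simp
  qed
  moreover have "((\<lambda>r. exp (- t * r powr \<alpha>)) has_real_derivative - (t * \<alpha> * \<mu> powr (\<alpha> - 1) * exp (- t * \<mu> powr \<alpha>))) (at \<mu>)"
    using \<mu> by (auto intro!: derivative_eq_intros simp: powr_diff field_simps)
  ultimately show ?thesis using DERIV_unique by fastforce
qed

text \<open>As a function of s, \<open>inv_density \<alpha> t s\<close> is s / (\<alpha> t) times
  the subordinator density at time t, so the transform is the expectation of X exp (- \<mu> X)
  divided by \<alpha> t. The nonnegative integral is the form in which Tonelli uses it.\<close>

lemma nn_laplace_inv_density:
  assumes \<mu>: "0 < \<mu>"
  shows "(\<integral>\<^sup>+s. ennreal (exp (- \<mu> * s) * inv_density \<alpha> t s) \<partial>lborel) = ennreal (\<mu> powr (\<alpha> - 1) * exp (- t * \<mu> powr \<alpha>))"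
proof -
  have "(\<integral>\<^sup>+s. ennreal (exp (- \<mu> * s) * inv_density \<alpha> t s) \<partial>lborel)
      = (\<integral>\<^sup>+s. ennreal (sub_density \<alpha> s t) * ennreal (1 / (\<alpha> * t) * (s * exp (- \<mu> * s))) \<partial>lborel)"
  proof (intro nn_integral_cong)
    fix s :: real
    show "ennreal (exp (- \<mu> * s) * inv_density \<alpha> t s) = ennreal (sub_density \<alpha> s t) * ennreal (1 / (\<alpha> * t) * (s * exp (- \<mu> * s)))"
      using t sub_density_nonneg[of s t]
      by (cases "s \<le> 0") (auto simp: inv_density_def sub_density_nonpos field_simps simp flip: ennreal_mult')
  qed
  also have "\<dots> = (\<integral>\<^sup>+\<omega>. ennreal (1 / (\<alpha> * t) * (X \<omega> * exp (- \<mu> * X \<omega>))) \<partial>M)"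
    by (intro distributed_nn_integral[OF distributed_sub_density]) auto
  also have "\<dots> = ennreal (expectation (\<lambda>\<omega>. 1 / (\<alpha> * t) * (X \<omega> * exp (- \<mu> * X \<omega>))))"
  proof (intro nn_integral_eq_integral integrable_mult_right AE_I2)
    show "integrable M (\<lambda>\<omega>. X \<omega> * exp (- \<mu> * X \<omega>))"
      by (rule integrable_const_bound[where B = "1 / \<mu>"])
         (use mult_exp_minus_le[OF \<mu>] nonneg in \<open>auto simp: abs_mult\<close>)
  qed (use nonneg \<alpha> t in auto)
  also have "expectation (\<lambda>\<omega>. 1 / (\<alpha> * t) * (X \<omega> * exp (- \<mu> * X \<omega>))) = \<mu> powr (\<alpha> - 1) * exp (- t * \<mu> powr \<alpha>)"
    using \<alpha> t by (simp only: integral_mult_right_zero expectation_mult_exp[OF \<mu>]) simp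
  finally show ?thesis .
qed

end

section \<open>The inverse process\<close>

lemma AE_eq_continuous_imp_eq:
  fixes f g :: "real \<Rightarrow> real"
  assumes ae: "AE x in lborel. f x = g x" and S: "open S" "continuous_on S f" "continuous_on S g" and x: "x \<in> S"
  shows "f x = g x"
proof (rule ccontr)
  assume "f x \<noteq> g x"
  define U where "U = {x \<in> S. f x - g x \<noteq> 0}"
  have "U = S \<inter> (\<lambda>x. f x - g x) -` (- {0})" by (auto simp: U_def)
  then have "open U" using S by (auto intro!: continuous_open_preimage continuous_intros)
  moreover have "x \<in> U" using x \<open>f x \<noteq> g x\<close> by (simp add: U_def)
  moreover have "U \<in> null_sets lborel"
  proof -
    have "AE x in lborel. x \<notin> U" using ae by eventually_elim (simp add: U_def)
    then show ?thesis using \<open>open U\<close> by (simp add: AE_iff_null_sets)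
  qed
  ultimately show False using open_not_negligible negligible_iff_null_sets null_sets_completionI by blast
qed

text \<open>Two such densities agree almost everywhere, hence by continuity everywhere on the open
  half-line, as a nonempty open set is not null; off it both are 0.\<close>

lemma (in prob_space) pdf_eqI:
  assumes "is_pdf M X f"
  shows "pdf M X = f"
  unfolding pdf_def
proof (rule the_equality[where P = "is_pdf M X", OF assms])
  fix g assume g: "is_pdf M X g"
  have ae: "AE x in lborel. ennreal (g x) = ennreal (f x)"
    using assms g by (intro distributed_unique[of _ X]) (auto simp: is_pdf_def)
  then have "AE x in lborel. g x = f x"
    using assms g by (auto simp: is_pdf_def)
  then have "g x = f x" if "0 < x" for x
    using that assms g by (intro AE_eq_continuous_imp_eq[where S = "{0<..}"]) (auto simp: is_pdf_def)
  then show "g = f"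
    using assms g unfolding is_pdf_def by (metis ext linorder_not_less)
qed

section \<open>First-passage times of nondecreasing processes\<close>

context prob_space begin

context
  fixes X :: "real \<Rightarrow> 'a \<Rightarrow> real" and t :: real
  assumes X: "\<And>s. 0 \<le> s \<Longrightarrow> random_variable borel (X s)"
    and mono: "\<And>\<omega>. \<omega> \<in> space M \<Longrightarrow> mono_on {0..} (\<lambda>s. X s \<omega>)"
begin

private abbreviation "S \<omega> \<equiv> {s. s > 0 \<and> X s \<omega> \<ge> t}"

private lemma S_upward: "\<omega> \<in> space M \<Longrightarrow> s \<in> S \<omega> \<Longrightarrow> s \<le> r \<Longrightarrow> r \<in> S \<omega>"
  using mono_onD[OF mono, of \<omega> s r] by auto

private lemma S_nonempty_iff: "\<omega> \<in> space M \<Longrightarrow> S \<omega> \<noteq> {} \<longleftrightarrow> (\<exists>n. t \<le> X (real (Suc n)) \<omega>)"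
proof
  assume \<omega>: "\<omega> \<in> space M" and "S \<omega> \<noteq> {}"
  then obtain s where s: "s \<in> S \<omega>" by blast
  obtain n where "s \<le> real n" using real_arch_simple by blast
  then have "real (Suc n) \<in> S \<omega>" using S_upward[OF \<omega> s, of "real (Suc n)"] by simp
  then show "\<exists>n. t \<le> X (real (Suc n)) \<omega>" by blast
next
  assume "\<exists>n. t \<le> X (real (Suc n)) \<omega>"
  then obtain n where "t \<le> X (real (Suc n)) \<omega>" by blast
  then have "real (Suc n) \<in> S \<omega>" by simp
  then show "S \<omega> \<noteq> {}" by blast
qed

private lemma bdd_S: "bdd_below (S \<omega>)"
  by (rule bdd_belowI[of _ 0]) auto

private lemma inverse_process_less_iff:
  assumes "\<omega> \<in> space M" "S \<omega> \<noteq> {}"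
  shows "inverse_process X t \<omega> < a \<longleftrightarrow> (\<exists>q::rat. of_rat q \<in> {0<..<a} \<and> t \<le> X (of_rat q) \<omega>)"
proof -
  have "inverse_process X t \<omega> < a \<longleftrightarrow> (\<exists>s\<in>S \<omega>. s < a)"
    unfolding inverse_process_def using assms(2) bdd_S by (rule cInf_less_iff)
  also have "\<dots> \<longleftrightarrow> (\<exists>q::rat. of_rat q \<in> {0<..<a} \<and> t \<le> X (of_rat q) \<omega>)"
  proof
    assume "\<exists>s\<in>S \<omega>. s < a"
    then obtain s where s: "s \<in> S \<omega>" "s < a" by blast
    then obtain q :: rat where q: "s < of_rat q" "of_rat q < a" using of_rat_dense by blast
    then have "of_rat q \<in> S \<omega>" using S_upward[OF assms(1) s(1), of "of_rat q"] by simp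
    then show "\<exists>q::rat. of_rat q \<in> {0<..<a} \<and> t \<le> X (of_rat q) \<omega>" using q by auto
  next
    assume "\<exists>q::rat. of_rat q \<in> {0<..<a} \<and> t \<le> X (of_rat q) \<omega>"
    then obtain q :: rat where "of_rat q \<in> {0<..<a}" "t \<le> X (of_rat q) \<omega>" by blast
    then have "of_rat q \<in> S \<omega>" "of_rat q < a" by auto
    then show "\<exists>s\<in>S \<omega>. s < a" by blast
  qed
  finally show ?thesis .
qed

text \<open>Monotonicity lets rational times detect passage before \<open>a\<close>, so countable
  unions suffice. Where no passage occurs the value is the fixed number \<open>Inf {}\<close>, so
  that part of the event is all or nothing.\<close>

lemma inverse_process_measurable: "random_variable borel (inverse_process X t)"
proof (rule borel_measurableI_less)
  fix a :: real
  define A where "A = {\<omega> \<in> space M. \<exists>n. t \<le> X (real (Suc n)) \<omega>}"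
  define B where "B = {\<omega> \<in> space M. \<exists>q\<in>{q::rat. of_rat q \<in> {0<..<a}}. t \<le> X (of_rat q) \<omega>}"
  have A: "A \<in> sets M" unfolding A_def using X by (intro sets.sets_Collect_countable_Ex) auto
  have "B = (\<Union>q\<in>{q::rat. of_rat q \<in> {0<..<a}}. {\<omega> \<in> space M. t \<le> X (of_rat q) \<omega>})"
    by (auto simp: B_def)
  also have "\<dots> \<in> sets M"
  proof (rule sets.countable_UN'')
    fix q :: rat assume "q \<in> {q. of_rat q \<in> {0<..<a}}"
    then have [measurable]: "random_variable borel (X (of_rat q))" by (intro X) auto
    show "{\<omega> \<in> space M. t \<le> X (of_rat q) \<omega>} \<in> sets M" by measurable
  qed simp
  finally have B: "B \<in> sets M" .
  have "inverse_process X t \<omega> < a \<longleftrightarrow> (if \<omega> \<in> A then \<omega> \<in> B else Inf {} < a)" if "\<omega> \<in> space M" for \<omega>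
  proof (cases "\<omega> \<in> A")
    case True
    then have "S \<omega> \<noteq> {}" using S_nonempty_iff[OF that] by (simp add: A_def)
    from inverse_process_less_iff[OF that this, of a] show ?thesis using True that by (auto simp: B_def)
  next
    case False
    then have "S \<omega> = {}" using S_nonempty_iff[OF that] that by (auto simp: A_def)
    then show ?thesis using False by (simp only: inverse_process_def if_False)
  qed
  then have "{\<omega> \<in> space M. inverse_process X t \<omega> < a} = (A \<inter> B) \<union> (if Inf {} < a then space M - A else {})"
    using sets.sets_into_space[OF A] by (auto split: if_splits)
  then show "{\<omega> \<in> space M. inverse_process X t \<omega> < a} \<in> sets M" using A B by auto
qed

text \<open>Passage by time x bounds the infimum by x at once. Conversely, an infimum of at most x
  only gives passage by every later r, outside the null set without passage; continuity in x lets r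
  decrease to x.\<close>

lemma prob_inverse_process_le:
  assumes x: "0 < x"
    and cont: "isCont (\<lambda>x. prob {\<omega> \<in> space M. t \<le> X x \<omega>}) x"
    and top: "((\<lambda>x. prob {\<omega> \<in> space M. t \<le> X x \<omega>}) \<longlongrightarrow> 1) at_top"
  shows "prob {\<omega> \<in> space M. inverse_process X t \<omega> \<le> x} = prob {\<omega> \<in> space M. t \<le> X x \<omega>}"
proof (rule antisym)
  note [measurable] = inverse_process_measurable
  have G: "{\<omega> \<in> space M. t \<le> X s \<omega>} \<in> events" if "0 \<le> s" for s
    using X[OF that] by measurable
  have E: "{\<omega> \<in> space M. S \<omega> = {}} \<in> events" (is "?E \<in> _")
  proof -
    have "{\<omega> \<in> space M. \<exists>n. t \<le> X (real (Suc n)) \<omega>} \<in> sets M"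
      using X by (intro sets.sets_Collect_countable_Ex) auto
    then have "space M - {\<omega> \<in> space M. \<exists>n. t \<le> X (real (Suc n)) \<omega>} \<in> sets M" by auto
    also have "space M - {\<omega> \<in> space M. \<exists>n. t \<le> X (real (Suc n)) \<omega>} = ?E"
      using S_nonempty_iff by blast
    finally show ?thesis .
  qed
  \<comment> \<open>Never passing has probability at most 1 - Pr{t \<le> X(s)} for each s > 0, and
    this tends to 0.\<close>
  have "prob ?E \<le> 0"
  proof (rule tendsto_lowerbound)
    show "((\<lambda>x. 1 - prob {\<omega> \<in> space M. t \<le> X x \<omega>}) \<longlongrightarrow> 0) at_top"
      using tendsto_diff[OF tendsto_const top, of 1] by simp
    show "\<forall>\<^sub>F s in at_top. prob ?E \<le> 1 - prob {\<omega> \<in> space M. t \<le> X s \<omega>}"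
      using eventually_gt_at_top[of 0]
    proof eventually_elim
      case (elim s)
      have "prob ?E \<le> prob (space M - {\<omega> \<in> space M. t \<le> X s \<omega>})"
        using elim G[of s] by (intro finite_measure_mono) auto
      then show ?case using prob_compl[OF G, of s] elim by simp
    qed
  qed simp
  then have E0: "prob ?E = 0" by (simp add: measure_le_0_iff)
  have up: "prob {\<omega> \<in> space M. inverse_process X t \<omega> \<le> x} \<le> prob {\<omega> \<in> space M. t \<le> X r \<omega>}" if "x < r" for r
  proof -
    have "{\<omega> \<in> space M. inverse_process X t \<omega> \<le> x} \<subseteq> {\<omega> \<in> space M. t \<le> X r \<omega>} \<union> ?E"
    proof (rule ccontr)
      assume "\<not> ?thesis"
      then obtain \<omega> where \<omega>: "\<omega> \<in> space M" "inverse_process X t \<omega> \<le> x" "\<not> t \<le> X r \<omega>" "S \<omega> \<noteq> {}" by blast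
      have "inverse_process X t \<omega> < r" using \<omega> that by simp
      then obtain u where "u \<in> S \<omega>" "u < r"
        unfolding inverse_process_def using cInf_less_iff[OF \<omega>(4) bdd_S] by blast
      then show False using S_upward[OF \<omega>(1), of u r] \<omega>(3) by simp
    qed
    then have "prob {\<omega> \<in> space M. inverse_process X t \<omega> \<le> x} \<le> prob ({\<omega> \<in> space M. t \<le> X r \<omega>} \<union> ?E)"
      using x that by (intro finite_measure_mono sets.Un G E) auto
    also have "\<dots> \<le> prob {\<omega> \<in> space M. t \<le> X r \<omega>} + prob ?E"
      using x that by (intro measure_Un_le G E) auto
    finally show ?thesis using E0 by linarith
  qed
  show "prob {\<omega> \<in> space M. inverse_process X t \<omega> \<le> x} \<le> prob {\<omega> \<in> space M. t \<le> X x \<omega>}"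
  proof (rule tendsto_lowerbound)
    show "((\<lambda>r. prob {\<omega> \<in> space M. t \<le> X r \<omega>}) \<longlongrightarrow> prob {\<omega> \<in> space M. t \<le> X x \<omega>}) (at_right x)"
      using cont by (simp add: isCont_def filterlim_at_split)
    show "\<forall>\<^sub>F r in at_right x. prob {\<omega> \<in> space M. inverse_process X t \<omega> \<le> x} \<le> prob {\<omega> \<in> space M. t \<le> X r \<omega>}"
      by (rule eventually_mono[OF eventually_at_right_less up])
  qed simp
  show "prob {\<omega> \<in> space M. t \<le> X x \<omega>} \<le> prob {\<omega> \<in> space M. inverse_process X t \<omega> \<le> x}"
  proof (rule finite_measure_mono)
    show "{\<omega> \<in> space M. t \<le> X x \<omega>} \<subseteq> {\<omega> \<in> space M. inverse_process X t \<omega> \<le> x}"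
      unfolding inverse_process_def using x by (auto intro!: cInf_lower bdd_S)
  qed measurable
qed

text \<open>\<open>bot\<close> rules out an atom of the passage time at 0 and \<open>top\<close> a
  positive probability of no passage, so the derivative in x captures the whole law.\<close>

lemma is_pdf_inverse_process:
  assumes deriv: "\<And>x. 0 < x \<Longrightarrow> ((\<lambda>x. prob {\<omega> \<in> space M. t \<le> X x \<omega>}) has_real_derivative g x) (at x)"
    and g: "continuous_on {0<..} g" "\<And>x. 0 \<le> g x" "\<And>x. x \<le> 0 \<Longrightarrow> g x = 0"
    and bot: "((\<lambda>x. prob {\<omega> \<in> space M. t \<le> X x \<omega>}) \<longlongrightarrow> 0) (at_right 0)"
    and top: "((\<lambda>x. prob {\<omega> \<in> space M. t \<le> X x \<omega>}) \<longlongrightarrow> 1) at_top"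
  shows "is_pdf M (inverse_process X t) g"
proof -
  note [measurable] = inverse_process_measurable
  let ?D = "distr M borel (inverse_process X t)"
  interpret D: prob_space ?D by (rule prob_space_distr) simp
  interpret D: real_distribution ?D by unfold_locales auto
  have cdf: "cdf ?D x = prob {\<omega> \<in> space M. t \<le> X x \<omega>}" if "0 < x" for x
  proof -
    have "cdf ?D x = prob {\<omega> \<in> space M. inverse_process X t \<omega> \<le> x}"
      by (simp add: cdf_def measure_distr vimage_def Int_def conj_commute)
    also have "\<dots> = prob {\<omega> \<in> space M. t \<le> X x \<omega>}"
      by (intro prob_inverse_process_le that top DERIV_isCont[OF deriv])
    finally show ?thesis .
  qed
  have "cdf ?D 0 \<le> 0"
  proof (rule tendsto_lowerbound[OF bot])
    show "\<forall>\<^sub>F x in at_right 0. cdf ?D 0 \<le> prob {\<omega> \<in> space M. t \<le> X x \<omega>}"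
      using eventually_at_right_less[of "0::real"]
    proof eventually_elim
      case (elim x)
      then show ?case using D.cdf_nondecreasing[of 0 x] cdf[of x] by simp
    qed
  qed simp
  then have cdf0: "cdf ?D 0 = 0" using D.cdf_nonneg[of 0] by simp
  have "(cdf ?D has_real_derivative g x) (at x)" if "0 < x" for x
    by (rule has_field_derivative_transform_within_open[OF deriv[OF that], of "{0<..}"]) (use that cdf in auto)
  note density = real_distribution_eq_density[OF D.real_distribution_axioms this g cdf0]
  then have "distributed M lborel (inverse_process X t) (\<lambda>x. ennreal (g x))"
    by (simp add: distributed_def cong: distr_cong)
  then show ?thesis using g by (simp add: is_pdf_def)
qed

end
end

text \<open>It depends on \<alpha> alone, so that variables at different times share one
  distribution function and the time can be differentiated.\<close>

definition stable_cdf :: "real \<Rightarrow> real \<Rightarrow> real" where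
  "stable_cdf \<alpha> = cdf (density lborel (\<lambda>x. ennreal (stable_density \<alpha> x)))"

context positive_stable begin

lemma cdf_eq_stable_cdf: "cdf (distr M borel Y) = stable_cdf \<alpha>"
proof -
  have "distr M borel Y = distr M lborel Y" by (rule distr_cong) auto
  then show ?thesis
    using distributed_distr_eq_density[OF stable_distributed] by (simp add: stable_cdf_def)
qed

lemma real_distribution_distr: "real_distribution (distr M borel Y)"
  by (simp add: real_distribution_def real_distribution_axioms_def prob_space_distr)

lemma stable_cdf_has_derivative: "(stable_cdf \<alpha> has_real_derivative stable_density \<alpha> x) (at x)"
  using cdf_has_derivative by (simp add: cdf_eq_stable_cdf)

lemma prob_less_eq_stable_cdf: "prob {\<omega> \<in> space M. Y \<omega> < u} = stable_cdf \<alpha> u"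
proof -
  interpret D: real_distribution "distr M borel Y" by (rule real_distribution_distr)
  have "stable_cdf \<alpha> u = measure (distr M borel Y) ({..<u} \<union> {u})"
    unfolding cdf_eq_stable_cdf[symmetric] cdf_def by (intro arg_cong2[where f = measure]) auto
  also have "\<dots> = measure (distr M borel Y) {..<u} + measure (distr M borel Y) {u}"
    by (rule D.finite_measure_Union) auto
  also have "\<dots> = prob {\<omega> \<in> space M. Y \<omega> < u}"
    by (simp add: measure_singleton measure_distr vimage_def Int_def conj_commute)
  finally show ?thesis by simp
qed

lemma stable_cdf_nonpos: "u \<le> 0 \<Longrightarrow> stable_cdf \<alpha> u = 0"
proof -
  assume "u \<le> 0"
  then have "{\<omega> \<in> space M. Y \<omega> < u} = {}" using nonneg by fastforce
  then show ?thesis unfolding prob_less_eq_stable_cdf[symmetric] by (simp only: measure_empty)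
qed

lemma stable_cdf_nonneg: "0 \<le> stable_cdf \<alpha> u"
  using prob_less_eq_stable_cdf[of u] by (metis measure_nonneg)

lemma stable_cdf_at_top: "(stable_cdf \<alpha> \<longlongrightarrow> 1) at_top"
proof -
  interpret D: real_distribution "distr M borel Y" by (rule real_distribution_distr)
  show ?thesis using D.cdf_lim_at_top_prob by (simp add: cdf_eq_stable_cdf)
qed

lemma continuous_on_stable_cdf: "continuous_on S (stable_cdf \<alpha>)"
  using DERIV_isCont[OF stable_cdf_has_derivative] by (simp add: continuous_at_imp_continuous_on)

text \<open>Time enters only through the scaling x^(-1/\<alpha>), so differentiating in time is the
  chain rule at the unit-time distribution function.\<close>

lemma stable_cdf_scaled_has_derivative:
  assumes x: "0 < x"
  shows "((\<lambda>x. stable_cdf \<alpha> (u * x powr (- 1 / \<alpha>))) has_real_derivative - inv_density \<alpha> x u) (at x)"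
proof -
  have "((\<lambda>x. u * x powr (- 1 / \<alpha>)) has_real_derivative - (u / (\<alpha> * x) * x powr (- 1 / \<alpha>))) (at x)"
  proof -
    have "((\<lambda>x. u * x powr (- 1 / \<alpha>)) has_real_derivative u * ((- 1 / \<alpha>) * x powr (- 1 / \<alpha> - 1))) (at x)"
      by (rule DERIV_cmult[OF has_real_derivative_powr[OF x]])
    also have "x powr (- 1 / \<alpha> - 1) = x powr (- 1 / \<alpha>) / x" using x by (simp only: powr_diff powr_one)
    finally show ?thesis using x by (simp add: field_simps)
  qed
  from DERIV_chain2[OF stable_cdf_has_derivative this] show ?thesis
    using x by (simp add: inv_density_def sub_density_def mult_ac)
qed

lemma stable_cdf_scaled_at_right_0:
  assumes "0 < u"
  shows "((\<lambda>x. stable_cdf \<alpha> (u * x powr (- 1 / \<alpha>))) \<longlongrightarrow> 1) (at_right 0)"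
proof (rule filterlim_compose[OF stable_cdf_at_top])
  show "LIM x at_right 0. u * x powr (- 1 / \<alpha>) :> at_top" using assms \<alpha> by real_asymp
qed

lemma stable_cdf_scaled_at_top:
  "((\<lambda>x. stable_cdf \<alpha> (u * x powr (- 1 / \<alpha>))) \<longlongrightarrow> 0) at_top"
proof -
  have "((\<lambda>x. x powr (- 1 / \<alpha>)) \<longlongrightarrow> 0) at_top" using \<alpha> by real_asymp
  then have "((\<lambda>x. u * x powr (- 1 / \<alpha>)) \<longlongrightarrow> u * 0) at_top" by (intro tendsto_intros)
  then have "((\<lambda>x. stable_cdf \<alpha> (u * x powr (- 1 / \<alpha>))) \<longlongrightarrow> stable_cdf \<alpha> (u * 0)) at_top"
    by (rule isCont_tendsto_compose[OF DERIV_isCont[OF stable_cdf_has_derivative]])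
  then show ?thesis by (simp add: stable_cdf_nonpos)
qed

end

lemma (in stable_law) prob_less: "prob {\<omega> \<in> space M. X \<omega> < u} = stable_cdf \<alpha> (u * t powr (- 1 / \<alpha>))"
proof -
  have "X \<omega> < u \<longleftrightarrow> t powr (- 1 / \<alpha>) * X \<omega> < u * t powr (- 1 / \<alpha>)" for \<omega>
    using t by (simp add: mult.commute)
  then show ?thesis using std.prob_less_eq_stable_cdf[of "u * t powr (- 1 / \<alpha>)"] by simp
qed

lemma continuous_on_sub_density:
  assumes "0 < \<alpha>" "\<alpha> < 1" "continuous_on S f" "continuous_on S g" "\<And>z. z \<in> S \<Longrightarrow> 0 < g z"
  shows "continuous_on S (\<lambda>z. sub_density \<alpha> (f z) (g z))"
proof -
  have [simp]: "g z \<noteq> 0" if "z \<in> S" for z using assms(5)[OF that] by simp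
  show ?thesis
    unfolding sub_density_def
    by (intro continuous_intros assms continuous_on_compose2[OF continuous_on_stable_density[of \<alpha>]]) auto
qed

lemma continuous_on_inv_density:
  assumes "0 < \<alpha>" "\<alpha> < 1" "continuous_on S f" "continuous_on S g" "\<And>z. z \<in> S \<Longrightarrow> 0 < f z"
  shows "continuous_on S (\<lambda>z. inv_density \<alpha> (f z) (g z))"
proof -
  have "continuous_on S (\<lambda>z. g z / (\<alpha> * f z) * sub_density \<alpha> (g z) (f z))"
    using assms by (intro continuous_intros continuous_on_sub_density) force+
  then show ?thesis
    by (rule continuous_on_cong[THEN iffD1, rotated -1]) (auto simp: inv_density_def assms(5))
qed

lemma (in prob_space) indep_var_commute:
  assumes "indep_var S X T Y"
  shows "indep_var T Y S X"
proof -
  have sym: "indep_set B A" if I: "indep_set A B" for A B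
  proof (rule indep_setI)
    fix a b assume "a \<in> B" "b \<in> A"
    then show "prob (a \<inter> b) = prob a * prob b"
      using indep_setD[OF I, of b a] by (simp add: Int_commute mult.commute)
  qed (use indep_setD_ev1[OF I] indep_setD_ev2[OF I] in auto)
  show ?thesis using assms unfolding indep_var_eq by (blast intro: sym)
qed

section \<open>Sums of independent stable processes\<close>

text \<open>A gauge integral, to which the parameter continuity and Leibniz rules apply. For
  positive x and y the integrand is continuous on all of [0, t]: in spite of the factor 1 /
  s^\<alpha> in its Wright form, \<open>inv_density\<close> tends to 0 with s. The times are kept
  separate for partial differentiation.\<close>

definition conv_density :: "real \<Rightarrow> real \<Rightarrow> real \<Rightarrow> real \<Rightarrow> real \<Rightarrow> real" where
  "conv_density \<alpha> \<beta> t x y = integral {0..t} (\<lambda>s. inv_density \<alpha> x s * sub_density \<beta> (t - s) y)"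

lemma continuous_on_conv_density:
  assumes "0 < \<alpha>" "\<alpha> < 1" "0 < \<beta>" "\<beta> < 1" "continuous_on S f" "continuous_on S g"
    "\<And>z. z \<in> S \<Longrightarrow> 0 < f z" "\<And>z. z \<in> S \<Longrightarrow> 0 < g z"
  shows "continuous_on S (\<lambda>z. conv_density \<alpha> \<beta> t (f z) (g z))"
proof -
  have "continuous_on ({0<..} \<times> {0<..}) (\<lambda>p. integral (cbox 0 t) (\<lambda>s. inv_density \<alpha> (fst p) s * sub_density \<beta> (t - s) (snd p)))"
    by (rule integral_continuous_on_param)
       (auto simp: case_prod_unfold intro!: continuous_intros continuous_on_inv_density continuous_on_sub_density assms)
  from continuous_on_compose2[OF this continuous_on_Pair[OF assms(5,6)]] show ?thesis
    using assms(7,8) by (auto simp: conv_density_def)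
qed

text \<open>Two families with unrelated time parameters. One-time laws and independence of pairs are
  what is recorded, so that rescaled processes fit in.\<close>

locale stable_pair = prob_space M for M :: "'a measure" +
  fixes \<alpha> \<beta> :: real and X Y :: "real \<Rightarrow> 'a \<Rightarrow> real"
  assumes X: "\<And>x. 0 < x \<Longrightarrow> stable_law M \<alpha> x (X x)"
    and Y: "\<And>y. 0 < y \<Longrightarrow> stable_law M \<beta> y (Y y)"
    and indep: "\<And>x y. 0 < x \<Longrightarrow> 0 < y \<Longrightarrow> indep_var borel (X x) borel (Y y)"
begin

sublocale X1: stable_law M \<alpha> 1 "X 1" by (rule X) simp
sublocale Y1: stable_law M \<beta> 1 "Y 1" by (rule Y) simp

text \<open>Conditioning on \<open>Y y\<close>, which contributes its density, leaves
  \<open>X x\<close> through its distribution function, the one factor depending on x. Both factors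
  vanish at negative arguments, which cuts the integral to [0, t].\<close>

lemma prob_sum_less:
  assumes x: "0 < x" and y: "0 < y" and t: "0 < t"
  shows "prob {\<omega> \<in> space M. X x \<omega> + Y y \<omega> < t} =
    integral {0..t} (\<lambda>s. stable_cdf \<alpha> (s * x powr (- 1 / \<alpha>)) * sub_density \<beta> (t - s) y)"
proof -
  interpret X: stable_law M \<alpha> x "X x" by (rule X[OF x])
  interpret Y: stable_law M \<beta> y "Y y" by (rule Y[OF y])
  interpret DX: prob_space "distr M borel (X x)" by (rule prob_space_distr) simp
  interpret DY: prob_space "distr M borel (Y y)" by (rule prob_space_distr) simp
  interpret P: pair_sigma_finite "distr M borel (X x)" "distr M borel (Y y)" ..
  note [measurable] = X.rv Y.rv
  have [measurable]: "stable_cdf \<alpha> \<in> borel_measurable borel"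
    by (auto intro!: borel_measurable_continuous_onI X.std.continuous_on_stable_cdf)
  have [measurable]: "(\<lambda>s. sub_density \<beta> s y) \<in> borel_measurable borel" using Y.\<alpha> by measurable
  have eq: "distr M borel (X x) \<Otimes>\<^sub>M distr M borel (Y y) = distr M (borel \<Otimes>\<^sub>M borel) (\<lambda>\<omega>. (X x \<omega>, Y y \<omega>))"
    using indep[OF x y] by (simp add: indep_var_distribution_eq)
  define A where "A = {p :: real \<times> real. fst p + snd p < t}"
  have A[measurable]: "A \<in> sets (borel \<Otimes>\<^sub>M borel)" 
  proof -
    have "open A" unfolding A_def by (intro open_Collect_less continuous_intros)
    then show ?thesis by (simp only: borel_prod borel_open)
  qed
  have cont: "continuous_on {0..t} (\<lambda>s. stable_cdf \<alpha> (s * x powr (- 1 / \<alpha>)) * sub_density \<beta> (t - s) y)"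
    by (intro continuous_intros continuous_on_sub_density continuous_on_compose2[OF X.std.continuous_on_stable_cdf[of UNIV]] Y.\<alpha>) (use y in auto)
  have A': "A \<in> sets (distr M borel (X x) \<Otimes>\<^sub>M distr M borel (Y y))"
    unfolding eq by simp
  have "ennreal (prob {\<omega> \<in> space M. X x \<omega> + Y y \<omega> < t}) = emeasure (distr M (borel \<Otimes>\<^sub>M borel) (\<lambda>\<omega>. (X x \<omega>, Y y \<omega>))) A"
    by (subst emeasure_distr[OF _ A]) (auto simp: A_def emeasure_eq_measure intro!: arg_cong[where f = prob])
  also have "\<dots> = (\<integral>\<^sup>+s. emeasure (distr M borel (X x)) ((\<lambda>r. (r, s)) -` A) \<partial>distr M borel (Y y))"
    unfolding eq[symmetric] by (rule P.emeasure_pair_measure_alt2[OF A'])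
  also have "\<dots> = (\<integral>\<^sup>+s. ennreal (stable_cdf \<alpha> ((t - s) * x powr (- 1 / \<alpha>))) \<partial>distr M borel (Y y))"
  proof (intro nn_integral_cong)
    fix s
    have "emeasure (distr M borel (X x)) ((\<lambda>r. (r, s)) -` A) = ennreal (prob {\<omega> \<in> space M. X x \<omega> < t - s})"
      by (subst emeasure_distr) (auto simp: A_def emeasure_eq_measure vimage_def algebra_simps intro!: arg_cong[where f = prob])
    then show "emeasure (distr M borel (X x)) ((\<lambda>r. (r, s)) -` A) = ennreal (stable_cdf \<alpha> ((t - s) * x powr (- 1 / \<alpha>)))"
      by (simp only: X.prob_less)
  qed
  also have "\<dots> = (\<integral>\<^sup>+\<omega>. ennreal (stable_cdf \<alpha> ((t - Y y \<omega>) * x powr (- 1 / \<alpha>))) \<partial>M)"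
    by (rule nn_integral_distr) auto
  also have "\<dots> = (\<integral>\<^sup>+s. ennreal (sub_density \<beta> s y) * ennreal (stable_cdf \<alpha> ((t - s) * x powr (- 1 / \<alpha>))) \<partial>lborel)"
    by (rule distributed_nn_integral[OF Y.distributed_sub_density, symmetric]) auto
  \<comment> \<open>The reflection s \<mapsto> t - s gives the plain argument to the factor that
    will be differentiated.\<close>
  also have "\<dots> = (\<integral>\<^sup>+s. ennreal (sub_density \<beta> (t + (-1) * s) y) * ennreal (stable_cdf \<alpha> ((t - (t + (-1) * s)) * x powr (- 1 / \<alpha>))) \<partial>lborel)"
    by (subst nn_integral_real_affine[where c = "-1" and t = t]) auto
  also have "\<dots> = (\<integral>\<^sup>+s. ennreal (indicator {0..t} s * (stable_cdf \<alpha> (s * x powr (- 1 / \<alpha>)) * sub_density \<beta> (t - s) y)) \<partial>lborel)"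
  proof (intro nn_integral_cong)
    fix s
    show "ennreal (sub_density \<beta> (t + (-1) * s) y) * ennreal (stable_cdf \<alpha> ((t - (t + (-1) * s)) * x powr (- 1 / \<alpha>))) =
      ennreal (indicator {0..t} s * (stable_cdf \<alpha> (s * x powr (- 1 / \<alpha>)) * sub_density \<beta> (t - s) y))"
      using X.std.stable_cdf_nonpos[of "s * x powr (- 1 / \<alpha>)"] Y.sub_density_nonpos[of "t - s" y] Y.sub_density_nonneg[of "t - s" y]
      by (auto simp: indicator_def mult_nonpos_nonneg mult.commute ennreal_mult' X.std.stable_cdf_nonneg)
  qed
  also have "\<dots> = ennreal (integral {0..t} (\<lambda>s. stable_cdf \<alpha> (s * x powr (- 1 / \<alpha>)) * sub_density \<beta> (t - s) y))"
  proof -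
    from cont have si: "set_integrable lborel {0..t} (\<lambda>s. stable_cdf \<alpha> (s * x powr (- 1 / \<alpha>)) * sub_density \<beta> (t - s) y)"
      by (rule borel_integrable_atLeastAtMost')
    then show ?thesis
      unfolding set_borel_integral_eq_integral(2)[OF si, symmetric] set_lebesgue_integral_def set_integrable_def real_scaleR_def
      by (intro nn_integral_eq_integral) (auto simp: X.std.stable_cdf_nonneg Y.sub_density_nonneg)
  qed
  finally have "ennreal (prob {\<omega> \<in> space M. X x \<omega> + Y y \<omega> < t}) = ennreal (integral {0..t} (\<lambda>s. stable_cdf \<alpha> (s * x powr (- 1 / \<alpha>)) * sub_density \<beta> (t - s) y))" .
  moreover have "0 \<le> integral {0..t} (\<lambda>s. stable_cdf \<alpha> (s * x powr (- 1 / \<alpha>)) * sub_density \<beta> (t - s) y)"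
    by (intro Henstock_Kurzweil_Integration.integral_nonneg integrable_continuous_real[OF cont] mult_nonneg_nonneg
        X.std.stable_cdf_nonneg Y.sub_density_nonneg)
  ultimately show ?thesis using ennreal_inj measure_nonneg by metis
qed

text \<open>Under the integral the derivative in x meets only the distribution function, which it
  turns into minus an inverse density.\<close>

lemma prob_sum_less_has_derivative:
  assumes x: "0 < x" and y: "0 < y" and t: "0 < t"
  shows "((\<lambda>x. prob {\<omega> \<in> space M. X x \<omega> + Y y \<omega> < t}) has_real_derivative - conv_density \<alpha> \<beta> t x y) (at x)"
proof -
  have cont: "continuous_on (cbox 0 t) (\<lambda>s. stable_cdf \<alpha> (s * z powr (- 1 / \<alpha>)) * sub_density \<beta> (t - s) y)" for z
    by (intro continuous_intros continuous_on_sub_density continuous_on_compose2[OF X1.std.continuous_on_stable_cdf[of UNIV]] Y1.\<alpha>) (use y in auto)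
  have "((\<lambda>x. integral (cbox 0 t) (\<lambda>s. stable_cdf \<alpha> (s * x powr (- 1 / \<alpha>)) * sub_density \<beta> (t - s) y))
      has_real_derivative integral (cbox 0 t) (\<lambda>s. - inv_density \<alpha> x s * sub_density \<beta> (t - s) y)) (at x within {0<..})"
  proof (rule leibniz_rule_field_derivative)
    show "((\<lambda>x. stable_cdf \<alpha> (s * x powr (- 1 / \<alpha>)) * sub_density \<beta> (t - s) y) has_real_derivative - inv_density \<alpha> z s * sub_density \<beta> (t - s) y) (at z within {0<..})"
      if "z \<in> {0<..}" for z s
      using that by (intro DERIV_cmult_right has_field_derivative_at_within[OF X1.std.stable_cdf_scaled_has_derivative]) auto
    show "(\<lambda>s. stable_cdf \<alpha> (s * z powr (- 1 / \<alpha>)) * sub_density \<beta> (t - s) y) integrable_on cbox 0 t" for z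
      by (rule integrable_continuous[OF cont])
    show "continuous_on ({0<..} \<times> cbox 0 t) (\<lambda>(x, s). - inv_density \<alpha> x s * sub_density \<beta> (t - s) y)"
      unfolding case_prod_unfold
      by (intro continuous_intros continuous_on_inv_density continuous_on_sub_density X1.\<alpha> Y1.\<alpha>) (use y in auto)
  qed (use x in auto)
  also have "integral (cbox 0 t) (\<lambda>s. - inv_density \<alpha> x s * sub_density \<beta> (t - s) y) = - conv_density \<alpha> \<beta> t x y"
    by (simp add: conv_density_def)
  finally have "((\<lambda>x. integral (cbox 0 t) (\<lambda>s. stable_cdf \<alpha> (s * x powr (- 1 / \<alpha>)) * sub_density \<beta> (t - s) y)) has_real_derivative - conv_density \<alpha> \<beta> t x y) (at x)"
    using x at_within_open[of x "{0<..}"] by simp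
  then show ?thesis
  proof (rule has_field_derivative_transform_within_open)
    show "open {0::real<..}" "x \<in> {0<..}" using x by auto
  qed (simp add: prob_sum_less y t)
qed

end

lemma (in stable_pair) swap: "stable_pair M \<beta> \<alpha> Y X"
  by (intro stable_pair.intro stable_pair_axioms.intro prob_space_axioms X Y indep_var_commute[OF indep])

section \<open>The line y = c x and the Laplace transform in t\<close>

context stable_pair begin

text \<open>Partial derivatives alone do not give the chain rule; continuity of the y-partial makes
  the probability jointly differentiable, and composing with x \<mapsto> (x, c x) brings in the
  factor c.\<close>

lemma prob_sum_less_chain:
  assumes x: "0 < x" and t: "0 < t" and c: "0 < c"
  shows "((\<lambda>x. prob {\<omega> \<in> space M. X x \<omega> + Y (c * x) \<omega> < t}) has_real_derivative
    - (conv_density \<alpha> \<beta> t x (c * x) + c * conv_density \<beta> \<alpha> t (c * x) x)) (at x)"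
proof -
  interpret swap: stable_pair M \<beta> \<alpha> Y X by (rule swap)
  let ?\<Psi> = "\<lambda>x y. prob {\<omega> \<in> space M. X x \<omega> + Y y \<omega> < t}"
  let ?S = "{0<..} :: real set"
  have cont: "continuous_on (?S \<times> ?S) (\<lambda>(x, y). blinfun_mult_right (- conv_density \<beta> \<alpha> t y x))"
    unfolding case_prod_unfold
    by (intro bounded_linear.continuous_on[OF bounded_linear_blinfun_mult_right] continuous_intros continuous_on_conv_density X1.\<alpha> Y1.\<alpha>) auto
  define y where "y = c * x"
  have y: "0 < y" using x c by (simp add: y_def)
  have "((\<lambda>(x, y). ?\<Psi> x y) has_derivative
      (\<lambda>(tx, ty). (- conv_density \<alpha> \<beta> t x y) * tx + blinfun_apply (blinfun_mult_right (- conv_density \<beta> \<alpha> t y x)) ty))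
      (at (x, y) within ?S \<times> ?S)"
  proof (rule has_derivative_partialsI[where fy = "\<lambda>x y. blinfun_mult_right (- conv_density \<beta> \<alpha> t y x)"])
    show "((\<lambda>x. ?\<Psi> x y) has_derivative (\<lambda>tx. (- conv_density \<alpha> \<beta> t x y) * tx)) (at x within ?S)"
      using prob_sum_less_has_derivative[OF x y t]
      unfolding has_field_derivative_def by (rule has_derivative_at_withinI)
    \<comment> \<open>With exchanged roles the same convolution puts the derivative on the
      distribution function of \<open>Y\<close>.\<close>
    show "((\<lambda>y. ?\<Psi> x y) has_derivative blinfun_apply (blinfun_mult_right (- conv_density \<beta> \<alpha> t y x))) (at y within ?S)"
      if "x \<in> ?S" "y \<in> ?S" for x y
    proof -
      have "((\<lambda>y. ?\<Psi> x y) has_derivative (*) (- conv_density \<beta> \<alpha> t y x)) (at y)"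
        using swap.prob_sum_less_has_derivative[of y x t] that t
        by (simp add: has_field_derivative_def add.commute)
      then show ?thesis
        unfolding blinfun_mult_right.rep_eq by (rule has_derivative_at_withinI)
    qed
    show "continuous (at (x, y) within ?S \<times> ?S) (\<lambda>(x, y). blinfun_mult_right (- conv_density \<beta> \<alpha> t y x))"
      using cont x y by (auto simp: continuous_on_eq_continuous_within)
  qed (use y in auto)
  then have "((\<lambda>(x, y). ?\<Psi> x y) has_derivative
      (\<lambda>(tx, ty). - conv_density \<alpha> \<beta> t x (c * x) * tx + (- conv_density \<beta> \<alpha> t (c * x) x) * ty)) (at (x, c * x))"
    unfolding y_def[symmetric] using x y by (simp add: at_within_open[of _ "?S \<times> ?S"] open_Times)
  moreover have "((\<lambda>x. (x, c * x)) has_derivative (\<lambda>h. (h, c * h))) (at x)"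
    by (auto intro!: derivative_eq_intros)
  ultimately have "((\<lambda>(x, y). ?\<Psi> x y) \<circ> (\<lambda>x. (x, c * x)) has_derivative
      (\<lambda>(tx, ty). - conv_density \<alpha> \<beta> t x (c * x) * tx + (- conv_density \<beta> \<alpha> t (c * x) x) * ty) \<circ> (\<lambda>h. (h, c * h))) (at x)"
    by (intro diff_chain_at)
  then show ?thesis
    unfolding has_field_derivative_def comp_def case_prod_conv
    by (rule has_derivative_eq_rhs) (simp add: fun_eq_iff algebra_simps)
qed

text \<open>The same integral read over the open interval, as the theorem states it, and as a
  nonnegative integral over the line, as Tonelli needs it; the integrand vanishes outside (0,
  t).\<close>

lemma
  assumes x: "0 < x" and y: "0 < y"
  shows set_integrable_conv_density: "set_integrable lborel {0<..<t} (\<lambda>s. inv_density \<alpha> x s * sub_density \<beta> (t - s) y)"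
    and conv_density_eq_LBINT: "conv_density \<alpha> \<beta> t x y = (LBINT s:{0<..<t}. inv_density \<alpha> x s * sub_density \<beta> (t - s) y)"
    and conv_density_nonneg: "0 \<le> conv_density \<alpha> \<beta> t x y"
    and ennreal_conv_density: "ennreal (conv_density \<alpha> \<beta> t x y) = (\<integral>\<^sup>+s. ennreal (inv_density \<alpha> x s) * ennreal (sub_density \<beta> (t - s) y) \<partial>lborel)"
proof -
  interpret X: stable_law M \<alpha> x "X x" by (rule X[OF x])
  interpret Y: stable_law M \<beta> y "Y y" by (rule Y[OF y])
  let ?f = "\<lambda>s. inv_density \<alpha> x s * sub_density \<beta> (t - s) y"
  have cont: "continuous_on S ?f" for S
    by (intro continuous_intros continuous_on_inv_density continuous_on_sub_density X.\<alpha> Y.\<alpha>) (use x y in auto)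
  have I: "set_integrable lborel {0..t} ?f" by (intro borel_integrable_atLeastAtMost' cont)
  then show J: "set_integrable lborel {0<..<t} ?f" by (rule set_integrable_subset) auto
  show eq: "conv_density \<alpha> \<beta> t x y = (LBINT s:{0<..<t}. ?f s)"
    unfolding conv_density_def set_borel_integral_eq_integral(2)[OF J] by (rule integral_open_interval_real)
  have nn: "0 \<le> ?f s" for s by (simp add: X.inv_density_nonneg Y.sub_density_nonneg)
  show "0 \<le> conv_density \<alpha> \<beta> t x y"
    unfolding eq set_lebesgue_integral_def using nn by (intro Bochner_Integration.integral_nonneg) simp
  have "ennreal (conv_density \<alpha> \<beta> t x y) = (\<integral>\<^sup>+s. ennreal (indicator {0<..<t} s * ?f s) \<partial>lborel)"
    unfolding eq set_lebesgue_integral_def real_scaleR_def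
    using J nn by (intro nn_integral_eq_integral[symmetric]) (auto simp: set_integrable_def)
  also have "\<dots> = (\<integral>\<^sup>+s. ennreal (inv_density \<alpha> x s) * ennreal (sub_density \<beta> (t - s) y) \<partial>lborel)"
  proof (rule nn_integral_cong)
    fix s
    show "ennreal (indicator {0<..<t} s * ?f s) = ennreal (inv_density \<alpha> x s) * ennreal (sub_density \<beta> (t - s) y)"
      using X.inv_density_nonpos[of s x] Y.sub_density_nonpos[of "t - s" y] X.inv_density_nonneg[of x s]
      by (cases "s \<le> 0"; cases "t \<le> s") (auto simp: ennreal_mult')
  qed
  finally show "ennreal (conv_density \<alpha> \<beta> t x y) = (\<integral>\<^sup>+s. ennreal (inv_density \<alpha> x s) * ennreal (sub_density \<beta> (t - s) y) \<partial>lborel)" .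
qed

text \<open>Tonelli and the shift t \<mapsto> s + t split the transform of the convolution into
  those of the inverse density and of the subordinator density.\<close>

lemma has_bochner_integral_laplace_conv_density:
  assumes x: "0 < x" and y: "0 < y" and \<mu>: "0 < \<mu>"
  shows "has_bochner_integral lborel (\<lambda>t. indicator {0<..} t *\<^sub>R (exp (- \<mu> * t) * conv_density \<alpha> \<beta> t x y))
    (\<mu> powr (\<alpha> - 1) * exp (- x * \<mu> powr \<alpha>) * exp (- y * \<mu> powr \<beta>))"
proof (rule has_bochner_integral_nn_integral)
  interpret X: stable_law M \<alpha> x "X x" by (rule X[OF x])
  interpret Y: stable_law M \<beta> y "Y y" by (rule Y[OF y])
  have [measurable]: "(\<lambda>s. sub_density \<beta> s y) \<in> borel_measurable borel" "(\<lambda>s. inv_density \<alpha> x s) \<in> borel_measurable borel"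
    using x y by (auto intro!: borel_measurable_continuous_onI continuous_on_sub_density continuous_on_inv_density X.\<alpha> Y.\<alpha> continuous_intros)
  \<comment> \<open>Measurability in t is read off the representation as a nonnegative
    integral.\<close>
  have "(\<lambda>t. enn2real (ennreal (conv_density \<alpha> \<beta> t x y))) \<in> borel_measurable borel"
    unfolding ennreal_conv_density[OF x y] by measurable
  then have [measurable]: "(\<lambda>t. conv_density \<alpha> \<beta> t x y) \<in> borel_measurable borel"
    by (simp add: conv_density_nonneg[OF x y])
  show "(\<lambda>t. indicator {0<..} t *\<^sub>R (exp (- \<mu> * t) * conv_density \<alpha> \<beta> t x y)) \<in> borel_measurable lborel" by measurable
  show "AE t in lborel. 0 \<le> indicator {0<..} t *\<^sub>R (exp (- \<mu> * t) * conv_density \<alpha> \<beta> t x y)"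
    by (simp add: conv_density_nonneg[OF x y])
  have "(\<integral>\<^sup>+t. ennreal (indicator {0<..} t *\<^sub>R (exp (- \<mu> * t) * conv_density \<alpha> \<beta> t x y)) \<partial>lborel)
      = (\<integral>\<^sup>+t. (\<integral>\<^sup>+s. ennreal (exp (- \<mu> * t)) * (ennreal (inv_density \<alpha> x s) * ennreal (sub_density \<beta> (t - s) y)) \<partial>lborel) \<partial>lborel)"
  proof (rule nn_integral_cong)
    fix t :: real
    have "conv_density \<alpha> \<beta> t x y = 0" if "t \<le> 0" using that by (simp add: conv_density_eq_LBINT[OF x y] set_lebesgue_integral_def)
    then have "ennreal (indicator {0<..} t *\<^sub>R (exp (- \<mu> * t) * conv_density \<alpha> \<beta> t x y)) = ennreal (exp (- \<mu> * t)) * ennreal (conv_density \<alpha> \<beta> t x y)"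
      by (cases "0 < t") (auto simp: ennreal_mult')
    also have "\<dots> = (\<integral>\<^sup>+s. ennreal (exp (- \<mu> * t)) * (ennreal (inv_density \<alpha> x s) * ennreal (sub_density \<beta> (t - s) y)) \<partial>lborel)"
      unfolding ennreal_conv_density[OF x y] by (rule nn_integral_cmult[symmetric]) measurable
    finally show "ennreal (indicator {0<..} t *\<^sub>R (exp (- \<mu> * t) * conv_density \<alpha> \<beta> t x y)) = \<dots>" .
  qed
  also have "\<dots> = (\<integral>\<^sup>+s. (\<integral>\<^sup>+t. ennreal (exp (- \<mu> * t)) * (ennreal (inv_density \<alpha> x s) * ennreal (sub_density \<beta> (t - s) y)) \<partial>lborel) \<partial>lborel)"
    by (rule lborel_pair.Fubini') measurable
  also have "\<dots> = (\<integral>\<^sup>+s. ennreal (exp (- \<mu> * s) * inv_density \<alpha> x s) * ennreal (exp (- y * \<mu> powr \<beta>)) \<partial>lborel)"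
  proof (rule nn_integral_cong)
    fix s :: real
    have "(\<integral>\<^sup>+t. ennreal (exp (- \<mu> * t)) * (ennreal (inv_density \<alpha> x s) * ennreal (sub_density \<beta> (t - s) y)) \<partial>lborel)
      = (\<integral>\<^sup>+t. ennreal (exp (- \<mu> * (s + 1 * t))) * (ennreal (inv_density \<alpha> x s) * ennreal (sub_density \<beta> (s + 1 * t - s) y)) \<partial>lborel)"
      by (subst nn_integral_real_affine[where c = 1 and t = s]) auto
    also have "\<dots> = (\<integral>\<^sup>+t. ennreal (exp (- \<mu> * s) * inv_density \<alpha> x s) * ennreal (exp (- \<mu> * t) * sub_density \<beta> t y) \<partial>lborel)"
      by (intro nn_integral_cong)
         (simp add: X.inv_density_nonneg Y.sub_density_nonneg algebra_simps exp_diff exp_minus divide_inverse flip: ennreal_mult')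
    also have "\<dots> = ennreal (exp (- \<mu> * s) * inv_density \<alpha> x s) * (\<integral>\<^sup>+t. ennreal (exp (- \<mu> * t) * sub_density \<beta> t y) \<partial>lborel)"
      by (rule nn_integral_cmult) measurable
    finally show "(\<integral>\<^sup>+t. ennreal (exp (- \<mu> * t)) * (ennreal (inv_density \<alpha> x s) * ennreal (sub_density \<beta> (t - s) y)) \<partial>lborel)
      = ennreal (exp (- \<mu> * s) * inv_density \<alpha> x s) * ennreal (exp (- y * \<mu> powr \<beta>))"
      by (simp only: Y.nn_laplace_sub_density[OF \<mu>])
  qed
  also have "\<dots> = (\<integral>\<^sup>+s. ennreal (exp (- \<mu> * s) * inv_density \<alpha> x s) \<partial>lborel) * ennreal (exp (- y * \<mu> powr \<beta>))"
    by (rule nn_integral_multc) measurable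
  also have "\<dots> = ennreal (\<mu> powr (\<alpha> - 1) * exp (- x * \<mu> powr \<alpha>) * exp (- y * \<mu> powr \<beta>))"
    unfolding X.nn_laplace_inv_density[OF \<mu>] by (rule ennreal_mult''[symmetric]) simp
  finally show "(\<integral>\<^sup>+t. ennreal (indicator {0<..} t *\<^sub>R (exp (- \<mu> * t) * conv_density \<alpha> \<beta> t x y)) \<partial>lborel)
    = ennreal (\<mu> powr (\<alpha> - 1) * exp (- x * \<mu> powr \<alpha>) * exp (- y * \<mu> powr \<beta>))" .
qed simp

lemma is_pdf_inverse_sum_process:
  assumes t: "0 < t" and c: "0 < c"
    and rv: "\<And>s. 0 \<le> s \<Longrightarrow> random_variable borel (Z s)"
    and mono: "\<And>\<omega>. \<omega> \<in> space M \<Longrightarrow> mono_on {0..} (\<lambda>s. Z s \<omega>)"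
    and Z: "\<And>s \<omega>. 0 < s \<Longrightarrow> Z s \<omega> = X s \<omega> + Y (c * s) \<omega>"
  shows "is_pdf M (inverse_process Z t)
    (\<lambda>x. if 0 < x then conv_density \<alpha> \<beta> t x (c * x) + c * conv_density \<beta> \<alpha> t (c * x) x else 0)"
    (is "is_pdf M _ ?g")
proof (rule is_pdf_inverse_process[OF rv mono])
  interpret swap: stable_pair M \<beta> \<alpha> Y X by (rule swap)
  let ?\<Psi> = "\<lambda>x. prob {\<omega> \<in> space M. X x \<omega> + Y (c * x) \<omega> < t}"
  have G: "prob {\<omega> \<in> space M. t \<le> Z x \<omega>} = 1 - ?\<Psi> x" if x: "0 < x" for x
  proof -
    note [measurable] = stable_law.rv[OF X[OF x]] stable_law.rv[OF Y[of "c * x"]]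
    have "{\<omega> \<in> space M. t \<le> Z x \<omega>} = space M - {\<omega> \<in> space M. X x \<omega> + Y (c * x) \<omega> < t}"
      by (auto simp: Z[OF x])
    then show ?thesis using x c by (simp add: prob_compl)
  qed
  show "((\<lambda>x. prob {\<omega> \<in> space M. t \<le> Z x \<omega>}) has_real_derivative ?g x) (at x)" if x: "0 < x" for x
  proof (rule has_field_derivative_transform_within_open)
    show "((\<lambda>x. 1 - ?\<Psi> x) has_real_derivative ?g x) (at x)"
      using DERIV_diff[OF DERIV_const prob_sum_less_chain[OF x t c], of 1] x by (simp add: add.commute)
    show "open {0::real<..}" "x \<in> {0<..}" using x by auto
  qed (simp add: G)
  have "continuous_on {0<..} (\<lambda>x. conv_density \<alpha> \<beta> t x (c * x) + c * conv_density \<beta> \<alpha> t (c * x) x)"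
    by (intro continuous_intros continuous_on_conv_density X1.\<alpha> Y1.\<alpha>) (use c in auto)
  then show "continuous_on {0<..} ?g" by (rule continuous_on_cong[THEN iffD1, rotated -1]) auto
  show "0 \<le> ?g x" for x
    using c by (simp add: conv_density_nonneg swap.conv_density_nonneg)
  show "?g x = 0" if "x \<le> 0" for x using that by simp
  \<comment> \<open>A sum that reaches t forces one summand to reach t / 2.\<close>
  have small: "prob {\<omega> \<in> space M. t \<le> Z x \<omega>} \<le> (1 - stable_cdf \<alpha> (t / 2 * x powr (- 1 / \<alpha>))) + (1 - stable_cdf \<beta> (t / 2 * (c * x) powr (- 1 / \<beta>)))"
    if x: "0 < x" for x
  proof -
    have cx: "0 < c * x" using c x by simp
    interpret X: stable_law M \<alpha> x "X x" by (rule X[OF x])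
    interpret Y: stable_law M \<beta> "c * x" "Y (c * x)" by (rule Y[OF cx])
    note [measurable] = X.rv Y.rv
    let ?A = "space M - {\<omega> \<in> space M. X x \<omega> < t / 2}" and ?B = "space M - {\<omega> \<in> space M. Y (c * x) \<omega> < t / 2}"
    have "prob {\<omega> \<in> space M. t \<le> Z x \<omega>} \<le> prob (?A \<union> ?B)"
      by (rule finite_measure_mono) (auto simp: Z[OF x])
    also have "\<dots> \<le> prob ?A + prob ?B" by (rule measure_Un_le) auto
    also have "prob ?A = 1 - prob {\<omega> \<in> space M. X x \<omega> < t / 2}" by (rule prob_compl) auto
    also have "prob ?B = 1 - prob {\<omega> \<in> space M. Y (c * x) \<omega> < t / 2}" by (rule prob_compl) auto
    finally show ?thesis by (simp only: X.prob_less Y.prob_less)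
  qed
  show "((\<lambda>x. prob {\<omega> \<in> space M. t \<le> Z x \<omega>}) \<longlongrightarrow> 0) (at_right 0)"
  proof (rule tendsto_sandwich[OF _ _ tendsto_const])
    have "LIM x at_right 0. c * x :> at_right 0" using c by real_asymp
    from filterlim_compose[OF Y1.std.stable_cdf_scaled_at_right_0 this, of "t / 2"] t
    have "((\<lambda>x. stable_cdf \<beta> (t / 2 * (c * x) powr (- 1 / \<beta>))) \<longlongrightarrow> 1) (at_right 0)" by simp
    moreover have "((\<lambda>x. stable_cdf \<alpha> (t / 2 * x powr (- 1 / \<alpha>))) \<longlongrightarrow> 1) (at_right 0)"
      using t by (intro X1.std.stable_cdf_scaled_at_right_0) simp
    ultimately have "((\<lambda>x. (1 - stable_cdf \<alpha> (t / 2 * x powr (- 1 / \<alpha>))) + (1 - stable_cdf \<beta> (t / 2 * (c * x) powr (- 1 / \<beta>)))) \<longlongrightarrow> (1 - 1) + (1 - 1)) (at_right 0)"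
      by (intro tendsto_intros)
    then show "((\<lambda>x. (1 - stable_cdf \<alpha> (t / 2 * x powr (- 1 / \<alpha>))) + (1 - stable_cdf \<beta> (t / 2 * (c * x) powr (- 1 / \<beta>)))) \<longlongrightarrow> 0) (at_right 0)" by simp
    show "\<forall>\<^sub>F x in at_right 0. prob {\<omega> \<in> space M. t \<le> Z x \<omega>} \<le>
        (1 - stable_cdf \<alpha> (t / 2 * x powr (- 1 / \<alpha>))) + (1 - stable_cdf \<beta> (t / 2 * (c * x) powr (- 1 / \<beta>)))"
      by (rule eventually_mono[OF eventually_at_right_less small])
  qed simp
  show "((\<lambda>x. prob {\<omega> \<in> space M. t \<le> Z x \<omega>}) \<longlongrightarrow> 1) at_top"
  proof (rule tendsto_sandwich[OF _ _ _ tendsto_const])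
    have "((\<lambda>x. 1 - stable_cdf \<alpha> (t * x powr (- 1 / \<alpha>))) \<longlongrightarrow> 1 - 0) at_top"
      by (intro tendsto_intros X1.std.stable_cdf_scaled_at_top)
    then show "((\<lambda>x. 1 - stable_cdf \<alpha> (t * x powr (- 1 / \<alpha>))) \<longlongrightarrow> 1) at_top" by simp
    show "\<forall>\<^sub>F x in at_top. 1 - stable_cdf \<alpha> (t * x powr (- 1 / \<alpha>)) \<le> prob {\<omega> \<in> space M. t \<le> Z x \<omega>}"
      using eventually_gt_at_top[of 0]
    proof eventually_elim
      case (elim x)
      then have cx: "0 < c * x" using c by simp
      interpret X: stable_law M \<alpha> x "X x" by (rule X[OF elim])
      interpret Y: stable_law M \<beta> "c * x" "Y (c * x)" by (rule Y[OF cx])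
      note [measurable] = X.rv Y.rv
      \<comment> \<open>The second summand is nonnegative, so a sum below t forces the first one
        below t.\<close>
      have "?\<Psi> x \<le> prob {\<omega> \<in> space M. X x \<omega> < t}"
        using Y.nonneg by (intro finite_measure_mono) force+
      then show ?case unfolding G[OF elim] X.prob_less by simp
    qed
  qed simp
qed

end

section \<open>The inverse of the sum of two stable subordinators\<close>

context stable_subordinator begin

lemma stable_law:
  assumes t: "0 < t"
  shows "stable_law M \<alpha> t (X t)"
proof unfold_locales
  show "0 \<le> X t \<omega>" if "\<omega> \<in> space M" for \<omega>
    using mono_onD[OF nondecreasing[OF that], of 0 t] start[OF that] t by simp
qed (use order t random_variable[of t] laplace_transform[OF t] in auto)

lemma pdf_eq_sub_density:
  assumes t: "0 < t"
  shows "pdf M (X t) = (\<lambda>x. sub_density \<alpha> x t)"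
proof (rule pdf_eqI)
  interpret L: stable_law M \<alpha> t "X t" by (rule stable_law[OF t])
  show "is_pdf M (X t) (\<lambda>x. sub_density \<alpha> x t)"
    unfolding is_pdf_def using L.distributed_sub_density t
    by (auto simp: L.sub_density_nonneg L.sub_density_nonpos intro!: continuous_on_sub_density order continuous_intros)
qed

text \<open>Here Pr{t \<le> X(x)} is 1 - F(t x^(-1/\<alpha>)) with F the unit-time distribution
  function, so the derivative and both limits come from scaling.\<close>

lemma pdf_inverse_process_eq_inv_density:
  assumes t: "0 < t"
  shows "pdf M (inverse_process X t) = (\<lambda>x. inv_density \<alpha> x t)"
proof (rule pdf_eqI, rule is_pdf_inverse_process[OF random_variable nondecreasing])
  interpret L: stable_law M \<alpha> 1 "X 1" by (rule stable_law) simp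
  have G: "prob {\<omega> \<in> space M. t \<le> X x \<omega>} = 1 - stable_cdf \<alpha> (t * x powr (- 1 / \<alpha>))" if x: "0 < x" for x
  proof -
    interpret X: stable_law M \<alpha> x "X x" by (rule stable_law[OF x])
    note [measurable] = X.rv
    have "{\<omega> \<in> space M. t \<le> X x \<omega>} = space M - {\<omega> \<in> space M. X x \<omega> < t}" by auto
    also have "prob \<dots> = 1 - prob {\<omega> \<in> space M. X x \<omega> < t}" by (rule prob_compl) measurable
    finally show ?thesis by (simp only: X.prob_less)
  qed
  show "((\<lambda>x. prob {\<omega> \<in> space M. t \<le> X x \<omega>}) has_real_derivative inv_density \<alpha> x t) (at x)" if x: "0 < x" for x
  proof (rule has_field_derivative_transform_within_open)
    show "((\<lambda>x. 1 - stable_cdf \<alpha> (t * x powr (- 1 / \<alpha>))) has_real_derivative inv_density \<alpha> x t) (at x)"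
      using DERIV_diff[OF DERIV_const L.std.stable_cdf_scaled_has_derivative[OF x, of t], of 1] by simp
    show "open {0::real<..}" "x \<in> {0<..}" using x by auto
  qed (simp add: G)
  show "continuous_on {0<..} (\<lambda>x. inv_density \<alpha> x t)"
    by (intro continuous_on_inv_density order continuous_intros) auto
  show "0 \<le> inv_density \<alpha> x t" for x by (rule L.inv_density_nonneg)
  show "inv_density \<alpha> x t = 0" if "x \<le> 0" for x using that by (simp add: inv_density_def)
  have "((\<lambda>x. 1 - stable_cdf \<alpha> (t * x powr (- 1 / \<alpha>))) \<longlongrightarrow> 1 - 1) (at_right 0)"
    by (intro tendsto_intros L.std.stable_cdf_scaled_at_right_0 t)
  then have "((\<lambda>x. 1 - stable_cdf \<alpha> (t * x powr (- 1 / \<alpha>))) \<longlongrightarrow> 0) (at_right 0)" by simp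
  then show "((\<lambda>x. prob {\<omega> \<in> space M. t \<le> X x \<omega>}) \<longlongrightarrow> 0) (at_right 0)"
    by (rule Lim_transform_eventually) (auto intro!: eventually_mono[OF eventually_at_right_less] simp: G)
  have "((\<lambda>x. 1 - stable_cdf \<alpha> (t * x powr (- 1 / \<alpha>))) \<longlongrightarrow> 1 - 0) at_top"
    by (intro tendsto_intros L.std.stable_cdf_scaled_at_top)
  then have "((\<lambda>x. 1 - stable_cdf \<alpha> (t * x powr (- 1 / \<alpha>))) \<longlongrightarrow> 1) at_top" by simp
  then show "((\<lambda>x. prob {\<omega> \<in> space M. t \<le> X x \<omega>}) \<longlongrightarrow> 1) at_top"
    by (rule Lim_transform_eventually) (auto intro!: eventually_mono[OF eventually_gt_at_top[of 0]] simp: G)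
qed

end

text \<open>A weight is traded for a speed: the Laplace exponent of c^(1/\<beta>) Y(y / c) is (y /
  c) (c^(1/\<beta>) \<mu>)^\<beta> = y \<mu>^\<beta>, that of a \<beta>-stable variable at time
  y.\<close>

lemma scaled_stable_pair:
  assumes X: "stable_subordinator M \<alpha> X" and Y: "stable_subordinator M \<beta> Y"
    and indep: "independent_processes M X Y" and c: "0 < c"
  shows "stable_pair M \<alpha> \<beta> X (\<lambda>y \<omega>. c powr (1 / \<beta>) * Y (y / c) \<omega>)"
proof -
  interpret X: stable_subordinator M \<alpha> X by (rule X)
  interpret Y: stable_subordinator M \<beta> Y by (rule Y)
  have k: "(c powr (1 / \<beta>)) powr \<beta> = c" "0 < c powr (1 / \<beta>)" using c Y.order by (auto simp: powr_powr)
  show ?thesis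
  proof (intro stable_pair.intro stable_pair_axioms.intro)
    show "prob_space M" by unfold_locales
    show "stable_law M \<alpha> x (X x)" if "0 < x" for x using that by (rule X.stable_law)
    show "stable_law M \<beta> y (\<lambda>\<omega>. c powr (1 / \<beta>) * Y (y / c) \<omega>)" if y: "0 < y" for y
    proof -
      interpret L: stable_law M \<beta> "y / c" "Y (y / c)" using y c by (intro Y.stable_law) simp
      show ?thesis
      proof unfold_locales
        fix \<mu> :: real assume "0 < \<mu>"
        then have "X.expectation (\<lambda>\<omega>. exp (- (\<mu> * c powr (1 / \<beta>)) * Y (y / c) \<omega>)) = exp (- (y / c) * (\<mu> * c powr (1 / \<beta>)) powr \<beta>)"
          using k by (intro L.laplace) simp
        also have "- (y / c) * (\<mu> * c powr (1 / \<beta>)) powr \<beta> = - y * \<mu> powr \<beta>"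
          using \<open>0 < \<mu>\<close> k c by (simp add: powr_mult)
        finally show "X.expectation (\<lambda>\<omega>. exp (- \<mu> * (c powr (1 / \<beta>) * Y (y / c) \<omega>))) = exp (- y * \<mu> powr \<beta>)"
          by (simp add: mult.assoc)
      qed (use Y.order y L.nonneg L.rv in auto)
    qed
    show "prob_space.indep_var M borel (X x) borel (\<lambda>\<omega>. c powr (1 / \<beta>) * Y (y / c) \<omega>)" if "0 < x" "0 < y" for x y
    proof -
      \<comment> \<open>Independence of whole paths passes to single times by composing with
        coordinate evaluations, one of them weighted.\<close>
      have "X.indep_var borel ((\<lambda>f. f x) \<circ> (\<lambda>\<omega>. \<lambda>t\<in>{0..}. X t \<omega>)) borel ((\<lambda>f. c powr (1 / \<beta>) * f (y / c)) \<circ> (\<lambda>\<omega>. \<lambda>t\<in>{0..}. Y t \<omega>))"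
      proof (rule X.indep_var_compose)
        show "X.indep_var (Pi\<^sub>M {0..} (\<lambda>_. borel)) (\<lambda>\<omega>. \<lambda>t\<in>{0..}. X t \<omega>) (Pi\<^sub>M {0..} (\<lambda>_. borel)) (\<lambda>\<omega>. \<lambda>t\<in>{0..}. Y t \<omega>)"
          using indep by (simp add: independent_processes_def)
        show "(\<lambda>f. f x) \<in> Pi\<^sub>M {0..} (\<lambda>_. borel) \<rightarrow>\<^sub>M borel"
          using that by (intro measurable_component_singleton) simp
        show "(\<lambda>f. c powr (1 / \<beta>) * f (y / c)) \<in> Pi\<^sub>M {0..} (\<lambda>_. borel) \<rightarrow>\<^sub>M borel"
          using that c by (intro borel_measurable_times borel_measurable_const measurable_component_singleton) simp
      qed
      moreover have "(\<lambda>f. f x) \<circ> (\<lambda>\<omega>. \<lambda>t\<in>{0..}. X t \<omega>) = X x" using that by (simp add: fun_eq_iff)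
      moreover have "(\<lambda>f. c powr (1 / \<beta>) * f (y / c)) \<circ> (\<lambda>\<omega>. \<lambda>t\<in>{0..}. Y t \<omega>) = (\<lambda>\<omega>. c powr (1 / \<beta>) * Y (y / c) \<omega>)"
        using that c by (simp add: fun_eq_iff)
      ultimately show ?thesis by simp
    qed
  qed
qed

theorem mainTheorem7:
  fixes M :: "'a measure" and \<nu> lam :: real
    and H1 H2 H L :: "real \<Rightarrow> 'a \<Rightarrow> real"
    and h\<^sub>2\<^sub>\<nu> h\<^sub>\<nu> l\<^sub>2\<^sub>\<nu> l\<^sub>\<nu> l :: "real \<Rightarrow> real \<Rightarrow> real"
  assumes "0 < \<nu>" "\<nu> < 1/2" "0 < lam"
    and "stable_subordinator M (2*\<nu>) H1"
    and "stable_subordinator M \<nu> H2"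
    and "independent_processes M H1 H2"
  defines "H \<equiv> \<lambda>t \<omega>. H1 t \<omega> + (2*lam) powr (1/\<nu>) * H2 t \<omega>"
    and "L \<equiv> inverse_process H"
    and "h\<^sub>2\<^sub>\<nu> \<equiv> \<lambda>x t. pdf M (H1 t) x"
    and "h\<^sub>\<nu> \<equiv> \<lambda>x t. pdf M (H2 t) x"
    and "l\<^sub>2\<^sub>\<nu> \<equiv> \<lambda>x t. pdf M (inverse_process H1 t) x"
    and "l\<^sub>\<nu> \<equiv> \<lambda>x t. pdf M (inverse_process H2 t) x"
    and "l \<equiv> \<lambda>x t. pdf M (L t) x"
  shows "(\<forall>t>0. is_pdf M (L t) (\<lambda>x. l x t)) \<and>
    (\<forall>x>0. \<forall>t>0.
       set_integrable lborel {0<..<t} (\<lambda>s. l\<^sub>2\<^sub>\<nu> x s * h\<^sub>\<nu> (t - s) (2*lam*x)) \<and>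
       set_integrable lborel {0<..<t} (\<lambda>s. l\<^sub>\<nu> (2*lam*x) s * h\<^sub>2\<^sub>\<nu> (t - s) x) \<and>
       l x t = (LBINT s:{0<..<t}. l\<^sub>2\<^sub>\<nu> x s * h\<^sub>\<nu> (t - s) (2*lam*x))
             + 2*lam * (LBINT s:{0<..<t}. l\<^sub>\<nu> (2*lam*x) s * h\<^sub>2\<^sub>\<nu> (t - s) x)) \<and>
    (\<forall>x>0. \<forall>t>0.
       set_integrable lborel {0<..<t} (\<lambda>s. 1 / s powr (2*\<nu>) *
         Wright (-2*\<nu>) (1 - 2*\<nu>) (- x / s powr (2*\<nu>)) * h\<^sub>\<nu> (t - s) (2*lam*x)) \<and>
       set_integrable lborel {0<..<t} (\<lambda>s. 1 / s powr \<nu> *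
         Wright (-\<nu>) (1 - \<nu>) (- 2*lam*x / s powr \<nu>) * h\<^sub>2\<^sub>\<nu> (t - s) x) \<and>
       l x t = (LBINT s:{0<..<t}. 1 / s powr (2*\<nu>) *
                  Wright (-2*\<nu>) (1 - 2*\<nu>) (- x / s powr (2*\<nu>)) * h\<^sub>\<nu> (t - s) (2*lam*x))
             + 2*lam * (LBINT s:{0<..<t}. 1 / s powr \<nu> *
                  Wright (-\<nu>) (1 - \<nu>) (- 2*lam*x / s powr \<nu>) * h\<^sub>2\<^sub>\<nu> (t - s) x)) \<and>
    (\<forall>x>0. \<forall>\<mu>>0.
       set_integrable lborel {0<..} (\<lambda>t. exp (-\<mu>*t) * l x t) \<and>
       (LBINT t:{0<..}. exp (-\<mu>*t) * l x t) =
         \<mu> powr (2*\<nu> - 1) * exp (-x * \<mu> powr (2*\<nu>)) * exp (-2*lam*x * \<mu> powr \<nu>)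
       + 2*lam * \<mu> powr (\<nu> - 1) * exp (-2*lam*x * \<mu> powr \<nu>) * exp (-x * \<mu> powr (2*\<nu>)))"
proof (intro conjI allI impI)
  interpret H1: stable_subordinator M "2 * \<nu>" H1 by fact
  interpret H2: stable_subordinator M \<nu> H2 by fact
  define k where "k = (2 * lam) powr (1 / \<nu>)"
  have k: "0 < k" using \<open>0 < lam\<close> by (simp add: k_def)
  \<comment> \<open>At y = 2 lam s this is k H2(s), so H(s) is the pair \<open>H1\<close>,
    \<open>Y\<close> read on the line y = 2 lam s.\<close>
  define Y where "Y = (\<lambda>y \<omega>. k * H2 (y / (2 * lam)) \<omega>)"
  have lam: "0 < 2 * lam" using \<open>0 < lam\<close> by simp
  interpret P: stable_pair M "2 * \<nu>" \<nu> H1 Y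
    unfolding Y_def k_def by (rule scaled_stable_pair) (use assms in auto)
  \<comment> \<open>The mirrored pair supplies the second term, whose inverse density has order
    \<nu>.\<close>
  interpret Q: stable_pair M \<nu> "2 * \<nu>" Y H1 by (rule P.swap)
  define g where "g = (\<lambda>x t. if 0 < x then conv_density (2 * \<nu>) \<nu> t x (2 * lam * x) + 2 * lam * conv_density \<nu> (2 * \<nu>) t (2 * lam * x) x else 0)"
  have pdf: "is_pdf M (L t) (\<lambda>x. g x t)" if "0 < t" for t
    unfolding L_def g_def
  proof (rule P.is_pdf_inverse_sum_process[OF that lam])
    show "H s \<in> borel_measurable M" if "0 \<le> s" for s
      unfolding H_def
      by (intro borel_measurable_add borel_measurable_times borel_measurable_const
          H1.random_variable[OF that] H2.random_variable[OF that])
    show "mono_on {0..} (\<lambda>s. H s \<omega>)" if "\<omega> \<in> space M" for \<omega>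
      using H1.nondecreasing[OF that] H2.nondecreasing[OF that]
      unfolding H_def mono_on_def by (auto intro!: add_mono mult_left_mono)
    show "H s \<omega> = H1 s \<omega> + Y (2 * lam * s) \<omega>" if "0 < s" for s \<omega>
      using lam by (simp add: H_def Y_def k_def)
  qed
  have l: "l x t = g x t" if "0 < t" for x t
    unfolding l_def by (simp add: H1.pdf_eqI[OF pdf[OF that]])
  show "is_pdf M (L t) (\<lambda>x. l x t)" if "0 < t" for t
    using pdf[OF that] by (simp add: l[OF that])
  fix x t \<mu> :: real
  assume x: "0 < x"
  have y: "0 < 2 * lam * x" using lam x by simp
  have h2: "h\<^sub>2\<^sub>\<nu> s x = sub_density (2 * \<nu>) s x" for s
    by (simp add: h\<^sub>2\<^sub>\<nu>_def H1.pdf_eq_sub_density[OF x])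
  have h1: "h\<^sub>\<nu> s (2 * lam * x) = sub_density \<nu> s (2 * lam * x)" for s
    by (simp add: h\<^sub>\<nu>_def H2.pdf_eq_sub_density[OF y])
  \<comment> \<open>Inverse densities are identified at positive s, which covers the open interval
    of integration.\<close>
  have l2: "l\<^sub>2\<^sub>\<nu> x s = inv_density (2 * \<nu>) x s" if "0 < s" for s
    by (simp add: l\<^sub>2\<^sub>\<nu>_def H1.pdf_inverse_process_eq_inv_density[OF that])
  have l1: "l\<^sub>\<nu> (2 * lam * x) s = inv_density \<nu> (2 * lam * x) s" if "0 < s" for s
    by (simp add: l\<^sub>\<nu>_def H2.pdf_inverse_process_eq_inv_density[OF that])
  have W2: "1 / s powr (2 * \<nu>) * Wright (- 2 * \<nu>) (1 - 2 * \<nu>) (- x / s powr (2 * \<nu>)) = inv_density (2 * \<nu>) x s" if "0 < s" for s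
    using inv_density_eq_Wright[OF x that H1.order] by simp
  have W1: "1 / s powr \<nu> * Wright (- \<nu>) (1 - \<nu>) (- 2 * lam * x / s powr \<nu>) = inv_density \<nu> (2 * lam * x) s" if "0 < s" for s
    using inv_density_eq_Wright[OF y that H2.order] by simp
  {
    assume t: "0 < t"
    note I = P.set_integrable_conv_density[OF x y, of t] Q.set_integrable_conv_density[OF y x, of t]
    note E = P.conv_density_eq_LBINT[OF x y, of t] Q.conv_density_eq_LBINT[OF y x, of t]
    have g: "g x t = conv_density (2 * \<nu>) \<nu> t x (2 * lam * x) + 2 * lam * conv_density \<nu> (2 * \<nu>) t (2 * lam * x) x"
      using x by (simp add: g_def)
    show "set_integrable lborel {0<..<t} (\<lambda>s. l\<^sub>2\<^sub>\<nu> x s * h\<^sub>\<nu> (t - s) (2*lam*x))"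
      by (rule set_integrable_cong[THEN iffD1, OF refl refl _ I(1)]) (simp add: h1 l2)
    show "set_integrable lborel {0<..<t} (\<lambda>s. l\<^sub>\<nu> (2*lam*x) s * h\<^sub>2\<^sub>\<nu> (t - s) x)"
      by (rule set_integrable_cong[THEN iffD1, OF refl refl _ I(2)]) (simp add: h2 l1)
    show "l x t = (LBINT s:{0<..<t}. l\<^sub>2\<^sub>\<nu> x s * h\<^sub>\<nu> (t - s) (2*lam*x))
             + 2*lam * (LBINT s:{0<..<t}. l\<^sub>\<nu> (2*lam*x) s * h\<^sub>2\<^sub>\<nu> (t - s) x)"
      unfolding l[OF t] g E
      by (intro arg_cong2[where f = "(+)"] arg_cong2[where f = "(*)"] refl set_lebesgue_integral_cong) (auto simp: h1 h2 l1 l2)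
    show "set_integrable lborel {0<..<t} (\<lambda>s. 1 / s powr (2*\<nu>) *
         Wright (-2*\<nu>) (1 - 2*\<nu>) (- x / s powr (2*\<nu>)) * h\<^sub>\<nu> (t - s) (2*lam*x))"
      by (rule set_integrable_cong[THEN iffD1, OF refl refl _ I(1)]) (simp only: h1 W2 greaterThanLessThan_iff)
    show "set_integrable lborel {0<..<t} (\<lambda>s. 1 / s powr \<nu> *
         Wright (-\<nu>) (1 - \<nu>) (- 2*lam*x / s powr \<nu>) * h\<^sub>2\<^sub>\<nu> (t - s) x)"
      by (rule set_integrable_cong[THEN iffD1, OF refl refl _ I(2)]) (simp only: h2 W1 greaterThanLessThan_iff)
    show "l x t = (LBINT s:{0<..<t}. 1 / s powr (2*\<nu>) *
                  Wright (-2*\<nu>) (1 - 2*\<nu>) (- x / s powr (2*\<nu>)) * h\<^sub>\<nu> (t - s) (2*lam*x))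
             + 2*lam * (LBINT s:{0<..<t}. 1 / s powr \<nu> *
                  Wright (-\<nu>) (1 - \<nu>) (- 2*lam*x / s powr \<nu>) * h\<^sub>2\<^sub>\<nu> (t - s) x)"
      unfolding l[OF t] g E
      by (intro arg_cong2[where f = "(+)"] arg_cong2[where f = "(*)"] refl set_lebesgue_integral_cong ballI allI impI)
         (simp_all only: h1 h2 W1 W2 greaterThanLessThan_iff, simp_all)
  next
    assume \<mu>: "0 < \<mu>"
    have "has_bochner_integral lborel (\<lambda>t. indicator {0<..} t *\<^sub>R (exp (-\<mu>*t) * l x t))
       (\<mu> powr (2*\<nu> - 1) * exp (-x * \<mu> powr (2*\<nu>)) * exp (-2*lam*x * \<mu> powr \<nu>)
       + 2*lam * \<mu> powr (\<nu> - 1) * exp (-2*lam*x * \<mu> powr \<nu>) * exp (-x * \<mu> powr (2*\<nu>)))"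
    proof (rule has_bochner_integral_cong[THEN iffD1, OF refl _ _
          has_bochner_integral_add[OF P.has_bochner_integral_laplace_conv_density[OF x y \<mu>]
            has_bochner_integral_mult_right[OF Q.has_bochner_integral_laplace_conv_density[OF y x \<mu>], of "2 * lam"]]])
      fix t :: real
      show "indicator {0<..} t *\<^sub>R (exp (- \<mu> * t) * conv_density (2 * \<nu>) \<nu> t x (2 * lam * x)) +
          2 * lam * (indicator {0<..} t *\<^sub>R (exp (- \<mu> * t) * conv_density \<nu> (2 * \<nu>) t (2 * lam * x) x)) =
          indicator {0<..} t *\<^sub>R (exp (-\<mu>*t) * l x t)"
        using x by (cases "0 < t") (auto simp: l g_def algebra_simps)
    qed (simp add: mult.assoc)
    then show "set_integrable lborel {0<..} (\<lambda>t. exp (-\<mu>*t) * l x t)"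
      "(LBINT t:{0<..}. exp (-\<mu>*t) * l x t) =
         \<mu> powr (2*\<nu> - 1) * exp (-x * \<mu> powr (2*\<nu>)) * exp (-2*lam*x * \<mu> powr \<nu>)
       + 2*lam * \<mu> powr (\<nu> - 1) * exp (-2*lam*x * \<mu> powr \<nu>) * exp (-x * \<mu> powr (2*\<nu>))"
      unfolding set_integrable_def set_lebesgue_integral_def by (auto simp: has_bochner_integral_iff)
  }
qed

end
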